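(* Let $\alpha\in(0,1]$, let $\{X_t\}_{t\ge 0}$ be the semi-Markov process with Mittag-Leffler sojourn times on $\{1,\dots,p,p+1\}$ described in the context, with initial distribution $\boldsymbol{\pi}=(\pi_1,\dots,\pi_p)$, $\pi_i=\mathbb{P}(X_0=i)$, $\sum_{i=1}^p\pi_i=1$, with associated matrix $\boldsymbol{T}$ and vector $\boldsymbol{t}$, and let $\tau=\inf\{t\ge 0: X_t=p+1\}$ be its absorption time. Let $\boldsymbol{R}=\{r_{ik}\}_{1\le i\le p,\,1\le k\le n}$ be a $p\times n$ matrix with non-negative entries and define $$Y_k=\int_0^\tau \sum_{i=1}^p r_{ik}\,1\{X_t=i\}\,dt,\qquad k=1,\dots,n,\qquad \boldsymbol{Y}=(Y_1,\dots,Y_n).$$ Then for every $\boldsymbol{\theta}=(\theta_1,\dots,\theta_n)\in[0,\infty)^n$, $$\mathbb{E}\left(e^{-\langle \boldsymbol{Y},\boldsymbol{\theta}\rangle}\right)=\boldsymbol{\pi}\left(\boldsymbol{\Delta}(\boldsymbol{R}\boldsymbol{\theta})^{\alpha}-\boldsymbol{T}\right)^{-1}\boldsymbol{t},$$ where $\boldsymbol{\Delta}(\boldsymbol{R}\boldsymbol{\theta})^{\alpha}$ is the $p\times p$ diagonal matrix with diagonal entries $\left(\sum_{k=1}^n r_{ik}\theta_k\right)^{\alpha}$, $i=1,\dots,p$.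
   Context: Mittag-Leffler distribution: for $\lambda>0$ and $0<\alpha\le 1$, $\mathrm{ML}(\alpha,\lambda)$ is the distribution on $(0,\infty)$ with density $\lambda x^{\alpha-1}E_{\alpha,\alpha}(-\lambda x^\alpha)$, where $E_{\alpha,\beta}(z)=\sum_{k=0}^\infty z^k/\Gamma(\alpha k+\beta)$. For $\alpha=1$ it is the exponential distribution with rate $\lambda$. Semi-Markov process: let $\{Z_n\}_{n\ge 0}$ be a Markov chain on $\{1,\dots,p,p+1\}$ with transition matrix $\boldsymbol{Q}=\{q_{ij}\}$, where states $1,\dots,p$ are transient, state $p+1$ is absorbing, and $q_{ii}=0$ for $i\le p$. Let $\lambda_1,\dots,\lambda_p>0$. For $i=1,\dots,p$ let $T^i_n$, $n=1,2,\dots$, be independent $\mathrm{ML}(\alpha,\lambda_i)$-distributed random variables (all independent of each other and of the chain). Put $S_0=0$ and $S_n=\sum_{m=1}^n T_m^{Z_{m-1}}$, and let $X_t=Z_{n-1}$ for $S_{n-1}\le t<S_n$; once the state $p+1$ is reached the process stays there forever. Thus $X$ jumps according to the chain $Z$ and its holding time in a state $i\le p$ is $\mathrm{ML}(\alpha,\lambda_i)$. The associated matrix $\boldsymbol{T}=\{t_{ij}\}_{i,j=1,\dots,p}$ has $t_{ij}=\lambda_i q_{ij}$ for $i\ne j$ and $t_{ii}=-\lambda_i$; the column vector $\boldsymbol{t}=(t_1,\dots,t_p)^\prime$ has $t_i=\lambda_i q_{i,p+1}$, so $\boldsymbol{t}=-\boldsymbol{T}\boldsymbol{e}$ with $\boldsymbol{e}$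 the column vector of ones. $\langle\cdot,\cdot\rangle$ is the Euclidean inner product, and $0^\alpha=0$. *)

theory Defs
  imports "HOL-Probability.Probability"
begin

subsection \<open>The Mittag-Leffler distribution\<close>

definition mittag_leffler :: "real \<Rightarrow> real \<Rightarrow> real \<Rightarrow> real" where
  "mittag_leffler a b z = (\<Sum>k. z ^ k / Gamma (a * real k + b))"

definition mittag_leffler_density :: "real \<Rightarrow> real \<Rightarrow> real \<Rightarrow> real" where
  "mittag_leffler_density \<alpha> l x =
     (if x > 0 then l * x powr (\<alpha> - 1) * mittag_leffler \<alpha> \<alpha> (- (l * x powr \<alpha>)) else 0)"

subsection \<open>Finite Markov chains\<close>

definition stochastic_matrix :: "real^'s^'s \<Rightarrow> bool" where
  "stochastic_matrix Q \<longleftrightarrow> (\<forall>i j. 0 \<le> Q $ i $ j) \<and> (\<forall>i. (\<Sum>j\<in>UNIV. Q $ i $ j) = 1)"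

definition markov_chain :: "'a measure \<Rightarrow> real^'s^'s \<Rightarrow> (nat \<Rightarrow> 'a \<Rightarrow> 's) \<Rightarrow> bool" where
  "markov_chain M Q Z \<longleftrightarrow>
     stochastic_matrix Q \<and>
     (\<forall>n. Z n \<in> measurable M (count_space UNIV)) \<and>
     (\<forall>n z. \<P>(\<omega> in M. \<forall>k\<le>n. Z k \<omega> = z k) > 0 \<longrightarrow>
        \<P>(\<omega> in M. Z (Suc n) \<omega> = z (Suc n) \<bar> \<forall>k\<le>n. Z k \<omega> = z k) = Q $ z n $ z (Suc n))"

text \<open>\<open>first_passage_prob Q j n i\<close> is the probability that a chain with transition matrix \<open>Q\<close>
  started in \<open>i\<close> visits \<open>j\<close> for the first time, time \<open>0\<close> not counted, at time \<open>n + 1\<close>.\<close>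

primrec first_passage_prob :: "real^'s^'s \<Rightarrow> 's \<Rightarrow> nat \<Rightarrow> 's \<Rightarrow> real" where
  "first_passage_prob Q j 0 i = Q $ i $ j"
| "first_passage_prob Q j (Suc n) i = (\<Sum>k\<in>UNIV - {j}. Q $ i $ k * first_passage_prob Q j n k)"

definition transient_state :: "real^'s^'s \<Rightarrow> 's \<Rightarrow> bool" where
  "transient_state Q i \<longleftrightarrow> (\<Sum>n. first_passage_prob Q i n i) < 1"

definition absorbing_state :: "real^'s^'s \<Rightarrow> 's \<Rightarrow> bool" where
  "absorbing_state Q i \<longleftrightarrow> Q $ i $ i = 1"

subsection \<open>The semi-Markov process\<close>

text \<open>The states \<open>1, \<dots>, p\<close> are the elements \<open>Some i\<close> of \<open>'p option\<close>, and \<open>p + 1\<close> is \<open>None\<close>.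
  Times are indexed from \<open>0\<close>: \<open>T i m\<close> is the variable written \<open>T\<^sup>i\<close> with index \<open>m + 1\<close>, so it is
  the sojourn time in \<open>i\<close> if \<open>Z m = Some i\<close>. The sojourn in \<open>None\<close> is infinite.\<close>

definition sojourn_time ::
  "(nat \<Rightarrow> 'a \<Rightarrow> 'p option) \<Rightarrow> ('p \<Rightarrow> nat \<Rightarrow> 'a \<Rightarrow> real) \<Rightarrow> nat \<Rightarrow> 'a \<Rightarrow> ereal" where
  "sojourn_time Z T m \<omega> = (case Z m \<omega> of Some i \<Rightarrow> ereal (T i m \<omega>) | None \<Rightarrow> \<infinity>)"

definition jump_time ::
  "(nat \<Rightarrow> 'a \<Rightarrow> 'p option) \<Rightarrow> ('p \<Rightarrow> nat \<Rightarrow> 'a \<Rightarrow> real) \<Rightarrow> nat \<Rightarrow> 'a \<Rightarrow> ereal" where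
  "jump_time Z T n \<omega> = (\<Sum>m<n. sojourn_time Z T m \<omega>)"

text \<open>Almost surely there is exactly one \<open>n\<close> as below for every \<open>t \<ge> 0\<close>; the choice of the least
  one matters only on a null set.\<close>

definition semi_markov_process ::
  "(nat \<Rightarrow> 'a \<Rightarrow> 'p option) \<Rightarrow> ('p \<Rightarrow> nat \<Rightarrow> 'a \<Rightarrow> real) \<Rightarrow> real \<Rightarrow> 'a \<Rightarrow> 'p option" where
  "semi_markov_process Z T t \<omega> =
     Z (LEAST n. jump_time Z T n \<omega> \<le> ereal t \<and> ereal t < jump_time Z T (Suc n) \<omega>) \<omega>"

definition absorption_time :: "(real \<Rightarrow> 'a \<Rightarrow> 'p option) \<Rightarrow> 'a \<Rightarrow> ereal" where
  "absorption_time X \<omega> = Inf {ereal t | t. 0 \<le> t \<and> X t \<omega> = None}"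

definition total_reward ::
  "(real \<Rightarrow> 'a \<Rightarrow> 'p option) \<Rightarrow> real^'n^'p \<Rightarrow> 'a \<Rightarrow> real^'n" where
  "total_reward X R \<omega> =
     (\<chi> k. LBINT t=0..absorption_time X \<omega>. (\<Sum>i\<in>UNIV. R $ i $ k * of_bool (X t \<omega> = Some i)))"

subsection \<open>The associated matrices\<close>

definition sub_intensity_matrix :: "real^'p \<Rightarrow> real^('p option)^('p option) \<Rightarrow> real^'p^'p" where
  "sub_intensity_matrix l Q =
     (\<chi> i j. if i = j then - (l $ i) else l $ i * Q $ Some i $ Some j)"

definition exit_vector :: "real^'p \<Rightarrow> real^('p option)^('p option) \<Rightarrow> real^'p" where
  "exit_vector l Q = (\<chi> i. l $ i * Q $ Some i $ None)"

definition diag_matrix :: "real^'p \<Rightarrow> real^'p^'p" where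
  "diag_matrix v = (\<chi> i j. if i = j then v $ i else 0)"

end

theory Submission
  imports Defs "HOL-Complex_Analysis.Cauchy_Integral_Formula"
begin

text \<open>
  Put \<open>s\<^sub>i = (R \<theta>)\<^sub>i\<close>. On a path that visits the states \<open>i\<^sub>0, \<dots>, i\<^sub>N\<^sub>-\<^sub>1\<close> before absorption, the inner product of
  \<open>Y\<close> and \<open>\<theta>\<close> is the sum of \<open>s\<close> at the visited states times the sojourn times (\<open>total_reward_eq\<close>).
  Given the chain, the sojourn times are independent, and a Mittag-Leffler variable with parameters
  \<open>\<alpha>, \<lambda>\<close> has Laplace transform \<open>\<lambda> / (\<lambda> + s\<^sup>\<alpha>)\<close> (\<open>mittag_leffler_expectation_exp\<close>). So the left-hand side is
  the probability that the chain reaches the absorbing state if on leaving a state \<open>i\<close> it survives only with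
  probability \<open>\<phi>\<^sub>i = \<lambda>\<^sub>i / (\<lambda>\<^sub>i + s\<^sub>i\<^sup>\<alpha>)\<close> (\<open>expectation_sojourn_product\<close>, \<open>markov_chain_expectation_prod\<close>). As
  a function \<open>w\<close> of the initial state this probability solves \<open>w = \<phi> \<cdot> Q w\<close> with value 1 at the
  absorbing state, which is the linear system of the theorem with its rows divided by \<open>\<lambda>\<^sub>i + s\<^sub>i\<^sup>\<alpha>\<close>
  (\<open>resolvent_equation_iff\<close>).

  The system has only one solution since transient states contain no non-empty closed set
  (\<open>closed_set_transient_empty\<close>, \<open>weighted_step_fixpoint_zero\<close>). The same fact gives almost sure absorption.

  The Laplace transform needs an analytic continuation, because its series converges only for
  \<open>s\<^sup>\<alpha> > \<lambda>\<close>, and the sign of the density is not known beforehand. Both points are settled together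
  in \<open>laplace_continuation\<close>: as the positive part of the density is known to have mass 1, a negative part
  would be visible near \<open>s = 0\<close>.
\<close>

section \<open>The Laplace transform of the Mittag-Leffler distribution\<close>

lemma nn_integral_powr_exp:
  fixes a s :: real assumes "a > 0" "s > 0"
  shows "(\<integral>\<^sup>+x. ennreal (indicator {0<..} x * x powr (a - 1) * exp (- (s * x))) \<partial>lborel) = ennreal (Gamma a * s powr (- a))"
proof -
  have *: "(\<integral>\<^sup>+x. indicator {0..} x * ennreal (x powr (a - 1) / exp x) \<partial>lborel) = ennreal (Gamma a)"
    unfolding Gamma_conv_nn_integral_real[OF assms(1)]
    by (intro nn_integral_cong) (auto simp: indicator_def)
  have "ennreal (Gamma a) = (\<integral>\<^sup>+x. ennreal (indicator {0<..} x * x powr (a - 1) * exp (- x)) \<partial>lborel)"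
    unfolding *[symmetric]
    by (intro nn_integral_cong_AE eventually_mono[OF AE_lborel_singleton[of 0]]) (auto simp: indicator_def exp_minus field_simps)
  also have "\<dots> = ennreal s * (\<integral>\<^sup>+x. ennreal (indicator {0<..} (s * x) * (s * x) powr (a - 1) * exp (- (s * x))) \<partial>lborel)"
    using assms by (subst nn_integral_real_affine[where c=s and t=0]) auto
  also have "\<dots> = ennreal s * (\<integral>\<^sup>+x. ennreal (s powr (a - 1)) * ennreal (indicator {0<..} x * x powr (a - 1) * exp (- (s * x))) \<partial>lborel)"
    using assms by (intro arg_cong2[where f="(*)"] nn_integral_cong refl)
      (auto simp: indicator_def powr_mult zero_less_mult_iff ennreal_mult'[symmetric] mult_ac)
  also have "\<dots> = ennreal (s powr a) * (\<integral>\<^sup>+x. ennreal (indicator {0<..} x * x powr (a - 1) * exp (- (s * x))) \<partial>lborel)"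
    using assms by (subst nn_integral_cmult) (auto simp: mult.assoc[symmetric] ennreal_mult'[symmetric] powr_diff)
  finally have "ennreal (s powr - a) * ennreal (Gamma a) = ennreal (s powr - a) * (ennreal (s powr a) * (\<integral>\<^sup>+x. ennreal (indicator {0<..} x * x powr (a - 1) * exp (- (s * x))) \<partial>lborel))" 
    by simp
  also have "\<dots> = (\<integral>\<^sup>+x. ennreal (indicator {0<..} x * x powr (a - 1) * exp (- (s * x))) \<partial>lborel)"
    using assms by (simp add: mult.assoc[symmetric] ennreal_mult'[symmetric] powr_add[symmetric])
  finally show ?thesis using assms by (simp add: ennreal_mult'[symmetric] mult.commute)
qed

text \<open>
  Integrating the series term by term gives a geometric series in \<open>- l / s powr \<alpha>\<close>, which is why
  only \<open>s\<close> with \<open>l < s powr \<alpha>\<close> are covered here. Convergence of the Mittag-Leffler series is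
  itself a consequence: the series of absolute values has a finite integral, hence is finite almost
  everywhere.
\<close>

lemma mittag_leffler_laplace_large:
  fixes \<alpha> l s :: real
  assumes "0 < \<alpha>" "0 < l" "0 < s" "l < s powr \<alpha>"
  shows "integrable lborel (\<lambda>x. mittag_leffler_density \<alpha> l x * exp (- (s * x)))"
    and "(\<integral>x. mittag_leffler_density \<alpha> l x * exp (- (s * x)) \<partial>lborel) = l / (l + s powr \<alpha>)"
proof -
  define r where "r = l / s powr \<alpha>"
  have r: "0 < r" "r < 1" using assms by (auto simp: r_def)
  define u where "u k x = l ^ Suc k / Gamma (\<alpha> * k + \<alpha>) *
      (indicator {0<..} x * x powr (\<alpha> * k + \<alpha> - 1) * exp (- (s * x)))" for k :: nat and x :: real
  have pos: "\<alpha> * k + \<alpha> > 0" for k :: nat using assms by (simp add: add_nonneg_pos)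
  have Gpos: "Gamma (\<alpha> * k + \<alpha>) > 0" for k :: nat using pos by (rule Gamma_real_pos)
  have u_nonneg: "0 \<le> u k x" for k x
    using assms Gpos[of k] by (auto simp: u_def intro!: mult_nonneg_nonneg divide_nonneg_nonneg less_imp_le[OF Gpos])
  have [measurable]: "u k \<in> borel_measurable borel" for k unfolding u_def by measurable
  have rpow: "l ^ Suc k * s powr (- (\<alpha> * k + \<alpha>)) = r ^ Suc k" for k :: nat
  proof -
    have "s powr (\<alpha> * k + \<alpha>) = (s powr \<alpha>) ^ Suc k"
      using assms by (simp add: powr_add powr_powr[symmetric] powr_realpow)
    then show ?thesis unfolding powr_minus by (simp only: r_def divide_inverse power_mult_distrib power_inverse)
  qed
  have nn: "(\<integral>\<^sup>+x. ennreal (u k x) \<partial>lborel) = ennreal (r ^ Suc k)" for k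
  proof -
    have "(\<integral>\<^sup>+x. ennreal (u k x) \<partial>lborel) = ennreal (l ^ Suc k / Gamma (\<alpha> * k + \<alpha>)) *
       (\<integral>\<^sup>+x. ennreal (indicator {0<..} x * x powr (\<alpha> * k + \<alpha> - 1) * exp (- (s * x))) \<partial>lborel)"
      unfolding u_def using assms less_imp_le[OF Gpos[of k]]
      by (subst nn_integral_cmult[symmetric])
         (auto intro!: nn_integral_cong simp: ennreal_mult[symmetric] simp del: power_Suc)
    also have "\<dots> = ennreal (l ^ Suc k / Gamma (\<alpha> * k + \<alpha>)) * ennreal (Gamma (\<alpha> * k + \<alpha>) * s powr (- (\<alpha> * k + \<alpha>)))"
      by (subst nn_integral_powr_exp[OF pos assms(3)]) simp
    also have "\<dots> = ennreal (l ^ Suc k * s powr (- (\<alpha> * k + \<alpha>)))"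
      using assms Gpos[of k] by (subst ennreal_mult[symmetric]) (auto simp del: power_Suc)
    finally show ?thesis unfolding rpow .
  qed
  have int_u: "integrable lborel (u k)" and val_u: "integral\<^sup>L lborel (u k) = r ^ Suc k" for k
    using nn[of k] u_nonneg r
    by (auto intro!: integrableI_nonneg integral_eq_nn_integral simp: ennreal_less_top integral_eq_nn_integral simp del: power_Suc)
  have "(\<integral>\<^sup>+x. (\<Sum>k. ennreal (u k x)) \<partial>lborel) = (\<Sum>k. ennreal (r ^ Suc k))"
    by (subst nn_integral_suminf) (auto simp: nn simp del: power_Suc)
  also have "\<dots> = ennreal (\<Sum>k. r ^ Suc k)"
    using r by (intro suminf_ennreal2) (auto intro!: summable_mult simp: summable_geometric)
  finally have "AE x in lborel. (\<Sum>k. ennreal (u k x)) \<noteq> \<infinity>"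
    by (intro nn_integral_noteq_infinite) auto
  then have summ: "AE x in lborel. summable (\<lambda>k. u k x)"
    by (rule eventually_mono) (auto intro!: summable_suminf_not_top u_nonneg)
  define v where "v k x = (-1) ^ k * u k x" for k x
  have [measurable]: "v k \<in> borel_measurable borel" for k unfolding v_def by measurable
  have int_v: "integrable lborel (v k)" for k unfolding v_def using int_u by auto
  have norm_v: "norm (v k x) = u k x" for k x using u_nonneg[of k x] by (simp add: v_def abs_mult)
  have summ_v: "AE x in lborel. summable (\<lambda>k. norm (v k x))"
    unfolding norm_v by (rule summ)
  have summ_iv: "summable (\<lambda>k. \<integral>x. norm (v k x) \<partial>lborel)"
    unfolding norm_v val_u using r by (simp add: summable_mult summable_geometric)
  have dens: "AE x in lborel. (\<Sum>k. v k x) = mittag_leffler_density \<alpha> l x * exp (- (s * x))"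
    using summ_v
  proof eventually_elim
    case (elim x)
    show ?case
    proof (cases "x > 0")
      case False
      then show ?thesis by (simp add: v_def u_def mittag_leffler_density_def)
    next
      case True
      have eq: "v k x = l * x powr (\<alpha> - 1) * exp (- (s * x)) * ((- (l * x powr \<alpha>)) ^ k / Gamma (\<alpha> * k + \<alpha>))" for k
      proof -
        have "x powr (\<alpha> * k + \<alpha> - 1) = x powr (\<alpha> - 1) * (x powr \<alpha>) ^ k"
          using True by (simp add: powr_realpow[symmetric] powr_powr powr_add[symmetric] algebra_simps)
        then show ?thesis using True
          by (simp add: v_def u_def power_minus[of "l * x powr \<alpha>"] power_mult_distrib)
      qed
      have nz: "l * x powr (\<alpha> - 1) * exp (- (s * x)) \<noteq> 0" using True assms by simp
      have "summable (\<lambda>k. (- (l * x powr \<alpha>)) ^ k / Gamma (\<alpha> * k + \<alpha>))"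
        using summable_norm_cancel[OF elim] unfolding eq summable_cmult_iff using nz by blast
      then show ?thesis using True unfolding eq
        by (subst suminf_mult) (auto simp: mittag_leffler_density_def mittag_leffler_def)
    qed
  qed
  have [measurable]: "mittag_leffler_density \<alpha> l \<in> borel_measurable borel"
    unfolding mittag_leffler_density_def[abs_def] mittag_leffler_def by measurable
  have "integrable lborel (\<lambda>x. \<Sum>k. v k x)"
    by (rule integrable_suminf[OF int_v summ_v summ_iv])
  then show "integrable lborel (\<lambda>x. mittag_leffler_density \<alpha> l x * exp (- (s * x)))"
    by (rule integrable_cong_AE_imp) (use dens in auto)
  have "(\<integral>x. mittag_leffler_density \<alpha> l x * exp (- (s * x)) \<partial>lborel) = (\<integral>x. (\<Sum>k. v k x) \<partial>lborel)"
    by (rule integral_cong_AE) (use dens in \<open>auto elim: eventually_mono\<close>)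
  also have "\<dots> = (\<Sum>k. integral\<^sup>L lborel (v k))"
    by (rule integral_suminf[OF int_v summ_v summ_iv])
  also have "\<dots> = (\<Sum>k. r * (- r) ^ k)"
    by (simp add: v_def[abs_def] val_u power_minus[of r] mult_ac)
  also have "\<dots> = r / (1 + r)"
    using r by (subst suminf_mult) (auto simp: suminf_geometric summable_geometric)
  also have "\<dots> = l / (l + s powr \<alpha>)"
    using assms by (simp add: r_def field_simps)
  finally show "(\<integral>x. mittag_leffler_density \<alpha> l x * exp (- (s * x)) \<partial>lborel) = l / (l + s powr \<alpha>)" .
qed

text \<open>
  Expanding \<open>exp (w * x)\<close> writes a Laplace transform, as a function of the distance \<open>w\<close> to the left
  of \<open>a\<close>, as a power series with non-negative coefficients. All terms being non-negative, the identity
  also holds when both sides are infinite.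
\<close>

lemma nn_laplace_power_series:
  fixes H :: "real \<Rightarrow> ennreal" and a w :: real
  assumes [measurable]: "H \<in> borel_measurable borel" and H0: "\<And>x. x \<le> 0 \<Longrightarrow> H x = 0" and w: "0 \<le> w"
  shows "(\<Sum>n. (\<integral>\<^sup>+x. H x * ennreal (x ^ n / fact n * exp (- (a * x))) \<partial>lborel) * ennreal (w ^ n))
     = (\<integral>\<^sup>+x. H x * ennreal (exp (- ((a - w) * x))) \<partial>lborel)"
proof -
  have "(\<Sum>n. (\<integral>\<^sup>+x. H x * ennreal (x ^ n / fact n * exp (- (a * x))) \<partial>lborel) * ennreal (w ^ n))
     = (\<integral>\<^sup>+x. (\<Sum>n. H x * ennreal (x ^ n / fact n * exp (- (a * x))) * ennreal (w ^ n)) \<partial>lborel)"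
    by (subst nn_integral_suminf) (auto simp: nn_integral_multc)
  also have "\<dots> = (\<integral>\<^sup>+x. H x * ennreal (exp (- ((a - w) * x))) \<partial>lborel)"
  proof (intro nn_integral_cong)
    fix x :: real
    show "(\<Sum>n. H x * ennreal (x ^ n / fact n * exp (- (a * x))) * ennreal (w ^ n)) =
        H x * ennreal (exp (- ((a - w) * x)))"
    proof (cases "x \<le> 0")
      case False
      have "(\<lambda>n. exp (- (a * x)) * ((w * x) ^ n /\<^sub>R fact n)) sums (exp (- (a * x)) * exp (w * x))"
        by (intro sums_mult exp_converges)
      then have "(\<lambda>n. x ^ n / fact n * exp (- (a * x)) * w ^ n) sums exp (- ((a - w) * x))"
        by (simp add: exp_add[symmetric] algebra_simps power_mult_distrib divide_inverse)
      then have "(\<Sum>n. ennreal (x ^ n / fact n * exp (- (a * x)) * w ^ n)) = ennreal (exp (- ((a - w) * x)))"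
        using False w by (intro suminf_ennreal_eq) auto
      then show ?thesis using False w
        by (simp add: mult.assoc ennreal_mult[symmetric] ennreal_suminf_cmult)
    qed (simp add: H0)
  qed
  finally show ?thesis .
qed

lemma laplace_power_series:
  fixes H :: "real \<Rightarrow> ennreal" and a :: real
  assumes [measurable]: "H \<in> borel_measurable borel" and H0: "\<And>x. x \<le> 0 \<Longrightarrow> H x = 0"
    and d: "0 < d" "(\<integral>\<^sup>+x. H x * ennreal (exp (- ((a - d) * x))) \<partial>lborel) < \<infinity>"
  obtains c :: "nat \<Rightarrow> real" where "\<And>n. 0 \<le> c n"
    "\<And>w. 0 \<le> w \<Longrightarrow> (\<Sum>n. ennreal (c n * w ^ n)) = (\<integral>\<^sup>+x. H x * ennreal (exp (- ((a - w) * x))) \<partial>lborel)"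
proof -
  define c where "c n = (\<integral>\<^sup>+x. H x * ennreal (x ^ n / fact n * exp (- (a * x))) \<partial>lborel)" for n
  have eq: "(\<Sum>n. c n * ennreal (w ^ n)) = (\<integral>\<^sup>+x. H x * ennreal (exp (- ((a - w) * x))) \<partial>lborel)"
    if "0 \<le> w" for w unfolding c_def using nn_laplace_power_series[OF assms(1,2) that] .
  have fin: "c n < top" for n
  proof -
    have "c n * ennreal (d ^ n) \<le> (\<Sum>n. c n * ennreal (d ^ n))"
      using sum_le_suminf[of "\<lambda>n. c n * ennreal (d ^ n)" "{n}"] by simp
    also have "\<dots> < top" using eq[of d] d by simp
    finally show ?thesis using d by (auto simp: ennreal_mult_less_top)
  qed
  show thesis
  proof (rule that[of "\<lambda>n. enn2real (c n)"])
    fix w :: real assume "0 \<le> w"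
    then show "(\<Sum>n. ennreal (enn2real (c n) * w ^ n)) = (\<integral>\<^sup>+x. H x * ennreal (exp (- ((a - w) * x))) \<partial>lborel)"
      using fin by (simp add: eq[symmetric] ennreal_mult)
  qed simp
qed

lemma power_series_eq_zero_right:
  fixes b :: "nat \<Rightarrow> real"
  assumes d: "0 < d" and sums: "\<And>w. 0 \<le> w \<Longrightarrow> w < d \<Longrightarrow> (\<lambda>n. b n * w ^ n) sums 0"
  shows "b n = 0"
proof (rule ccontr)
  assume n: "b n \<noteq> 0"
  have b0: "b 0 = 0" using sums[of 0] d by simp
  then have n0: "n > 0" using n by (cases n) auto
  have *: "(\<lambda>n. b n * (x - 0) ^ n) sums (\<Sum>n. b n * x ^ n)" if "norm (x - 0) < d / 2" for x
  proof -
    have "summable (\<lambda>n. b n * (d / 2) ^ n)" using sums[of "d/2"] d by (auto simp: sums_iff)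
    from powser_inside[OF this, of x] show ?thesis using that d by (auto simp: sums_iff)
  qed
  obtain s where s: "0 < s" "\<And>z. z \<in> cball 0 s - {0} \<Longrightarrow> (\<Sum>n. b n * z ^ n) \<noteq> 0"
    using powser_0_nonzero[OF half_gt_zero[OF d] * _ n n0] b0 by (metis powser_zero)
  have "(\<Sum>n. b n * (min s (d/2)) ^ n) = 0"
    using sums[of "min s (d/2)"] s(1) d by (simp add: sums_iff min_def)
  then show False using s(1) s(2)[of "min s (d/2)"] d by auto
qed

text \<open>
  The sign of \<open>f\<close> is unknown; the assumption on the mass bounds its positive part only. As in Landau's theorem on Laplace transforms of
  non-negative functions, the negative part cannot have an abscissa of convergence inside the domain
  of holomorphy: around a large \<open>a\<close>, the power series of the transform \<open>P\<close> of the positive part and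
  of \<open>\<phi>\<close> both converge up to distance \<open>a\<close>, so the series of the transform \<open>N\<close> of the negative part,
  which is their difference, does too. Thus \<open>N = P - g \<le> 1 - g\<close> on \<open>(0, a]\<close>; \<open>N\<close> is decreasing and
  \<open>g\<close> tends to 1 at 0, so \<open>N = 0\<close>.
\<close>

lemma laplace_continuation:
  fixes f :: "real \<Rightarrow> real" and g :: "real \<Rightarrow> real" and \<phi> :: "complex \<Rightarrow> complex"
  assumes meas[measurable]: "f \<in> borel_measurable borel" and f0: "\<And>x. x \<le> 0 \<Longrightarrow> f x = 0"
    and mass: "(\<integral>\<^sup>+x. ennreal (f x) \<partial>lborel) \<le> 1"
    and int: "\<And>s. s\<^sub>0 < s \<Longrightarrow> integrable lborel (\<lambda>x. f x * exp (- (s * x)))"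
    and val: "\<And>s. s\<^sub>0 < s \<Longrightarrow> (\<integral>x. f x * exp (- (s * x)) \<partial>lborel) = g s"
    and hol: "\<phi> holomorphic_on {z. 0 < Re z}" and \<phi>g: "\<And>s. 0 < s \<Longrightarrow> \<phi> (of_real s) = of_real (g s)"
    and lim: "(g \<longlongrightarrow> 1) (at_right 0)" and "0 < s"
  shows "(\<integral>\<^sup>+x. ennreal (f x) * ennreal (exp (- (s * x))) \<partial>lborel) = ennreal (g s)"
proof -
  define a where "a = max s s\<^sub>0 + 1"
  have a: "s < a" "s\<^sub>0 < a" "0 < a" using \<open>0 < s\<close> by (auto simp: a_def)
  define d where "d = min 1 (min a ((a - s\<^sub>0) / 2))"
  have d: "0 < d" "s\<^sub>0 < a - d" "d \<le> a" using a by (auto simp: d_def min_def field_simps)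
  define P where "P t = (\<integral>\<^sup>+x. ennreal (f x) * ennreal (exp (- (t * x))) \<partial>lborel)" for t
  define N where "N t = (\<integral>\<^sup>+x. ennreal (- f x) * ennreal (exp (- (t * x))) \<partial>lborel)" for t
  have P1: "P t \<le> 1" if "0 \<le> t" for t
  proof -
    have "P t \<le> (\<integral>\<^sup>+x. ennreal (f x) \<partial>lborel)" unfolding P_def
    proof (intro nn_integral_mono)
      fix x :: real
      have "ennreal (f x) * ennreal (exp (- (t * x))) \<le> ennreal (f x) * 1" if "0 < x"
        using that \<open>0 \<le> t\<close> by (intro mult_left_mono) auto
      then show "ennreal (f x) * ennreal (exp (- (t * x))) \<le> ennreal (f x)"
        using f0[of x] by (cases "x \<le> 0") auto
    qed
    then show ?thesis using mass by simp
  qed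
  have N_fin: "N t < \<infinity>" and PN: "enn2real (P t) - enn2real (N t) = g t" if "s\<^sub>0 < t" for t
  proof -
    have eq: "N t = (\<integral>\<^sup>+x. ennreal (- (f x * exp (- (t * x)))) \<partial>lborel)"
      "P t = (\<integral>\<^sup>+x. ennreal (f x * exp (- (t * x))) \<partial>lborel)"
      unfolding N_def P_def by (simp_all add: ennreal_mult''[symmetric])
    show "N t < \<infinity>" unfolding eq using int[OF that] by (auto simp: real_integrable_def less_top)
    show "enn2real (P t) - enn2real (N t) = g t"
      unfolding eq val[OF that, symmetric] by (rule real_lebesgue_integral_def[OF int[OF that], symmetric])
  qed
  have Pd: "(\<integral>\<^sup>+x. ennreal (f x) * ennreal (exp (- ((a - d) * x))) \<partial>lborel) < \<infinity>"
    using P1[of "a - d"] d by (simp add: P_def[symmetric] order_le_less_trans)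
  obtain p where p: "\<And>n. 0 \<le> p n" "\<And>w. 0 \<le> w \<Longrightarrow> (\<Sum>n. ennreal (p n * w ^ n)) = P (a - w)"
    unfolding P_def by (rule laplace_power_series[of "\<lambda>x. ennreal (f x)", OF _ _ d(1) Pd]) (auto simp: f0)
  have Nd: "(\<integral>\<^sup>+x. ennreal (- f x) * ennreal (exp (- ((a - d) * x))) \<partial>lborel) < \<infinity>"
    using N_fin[of "a - d"] d by (simp add: N_def[symmetric])
  obtain q where q: "\<And>n. 0 \<le> q n" "\<And>w. 0 \<le> w \<Longrightarrow> (\<Sum>n. ennreal (q n * w ^ n)) = N (a - w)"
    unfolding N_def by (rule laplace_power_series[of "\<lambda>x. ennreal (- f x)", OF _ _ d(1) Nd]) (auto simp: f0)
  have to_sums: "(\<lambda>n. c n * w ^ n) sums enn2real S"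
    if "\<And>n. 0 \<le> c n" "0 \<le> w" "(\<Sum>n. ennreal (c n * w ^ n)) = S" "S < \<infinity>" for c w S
  proof -
    have "summable (\<lambda>n. c n * w ^ n)" using that by (intro summable_suminf_not_top) auto
    then show ?thesis using that by (auto simp: sums_iff suminf_ennreal2 suminf_nonneg)
  qed
  have p_sums: "(\<lambda>n. p n * w ^ n) sums enn2real (P (a - w))" if "0 \<le> w" "w \<le> a" for w
    using to_sums[OF p(1) that(1) p(2)[OF that(1)]] P1[of "a - w"] that by (simp add: order_le_less_trans)
  have q_sums: "(\<lambda>n. q n * w ^ n) sums enn2real (N (a - w))" if "0 \<le> w" "w < d" for w
    using to_sums[OF q(1) that(1) q(2)[OF that(1)]] N_fin[of "a - w"] that d by simp
  \<comment> \<open>The sign accounts for expanding in \<open>w = a - z\<close> instead of \<open>z - a\<close>.\<close>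
  define b where "b n = Re ((deriv ^^ n) \<phi> (of_real a) / fact n) * (-1) ^ n" for n
  have b_sums: "(\<lambda>n. b n * w ^ n) sums g (a - w)" if "0 \<le> w" "w < a" for w
  proof -
    have "\<phi> holomorphic_on ball (of_real a) a"
    proof (rule holomorphic_on_subset[OF hol], safe)
      fix z assume "z \<in> ball (complex_of_real a) a"
      then have "\<bar>Re (complex_of_real a - z)\<bar> < a"
        using abs_Re_le_cmod[of "complex_of_real a - z"] by (auto simp: dist_norm)
      then show "0 < Re z" by auto
    qed
    then have "(\<lambda>n. (deriv ^^ n) \<phi> (of_real a) / fact n * (of_real (a - w) - of_real a) ^ n) sums \<phi> (of_real (a - w))"
      by (rule holomorphic_power_series) (use that in \<open>auto simp: dist_norm\<close>)
    then have "(\<lambda>n. Re ((deriv ^^ n) \<phi> (of_real a) / fact n * of_real ((- w) ^ n))) sums Re (of_real (g (a - w)))"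
      using \<phi>g[of "a - w"] that by (intro sums_Re) simp
    moreover have "Re (z * of_real ((- w) ^ n)) = Re z * (-1) ^ n * w ^ n" for z n
      by (simp add: power_minus[of w] mult.assoc del: of_real_mult of_real_power)
    ultimately show ?thesis unfolding b_def by (simp only: Re_complex_of_real)
  qed
  have q_eq: "q n = p n - b n" for n
  proof -
    have "p n - q n - b n = 0"
    proof (rule power_series_eq_zero_right[OF d(1)])
      fix w assume w: "0 \<le> w" "w < d"
      have "(\<lambda>n. p n * w ^ n - q n * w ^ n - b n * w ^ n) sums
          (enn2real (P (a - w)) - enn2real (N (a - w)) - g (a - w))"
        using w d by (intro sums_diff p_sums q_sums b_sums) auto
      then show "(\<lambda>n. (p n - q n - b n) * w ^ n) sums 0"
        using PN[of "a - w"] w d by (simp add: algebra_simps)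
    qed
    then show ?thesis by simp
  qed
  have N_le: "N t = ennreal (enn2real (P t) - g t)" "0 \<le> enn2real (P t) - g t" if "0 < t" "t \<le> a" for t
  proof -
    have "(\<lambda>n. p n * (a - t) ^ n - b n * (a - t) ^ n) sums (enn2real (P (a - (a - t))) - g (a - (a - t)))"
      using that by (intro sums_diff p_sums b_sums) auto
    then have *: "(\<lambda>n. q n * (a - t) ^ n) sums (enn2real (P t) - g t)"
      by (simp add: q_eq algebra_simps)
    then have "(\<Sum>n. ennreal (q n * (a - t) ^ n)) = ennreal (enn2real (P t) - g t)"
      using q that by (intro suminf_ennreal_eq) auto
    then show "N t = ennreal (enn2real (P t) - g t)" using q(2)[of "a - t"] that by simp
    show "0 \<le> enn2real (P t) - g t"
      using * q(1) that by (intro sums_le[OF _ sums_zero *]) auto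
  qed
  have N_small: "N s \<le> ennreal (1 - g t)" if "0 < t" "t \<le> s" for t
  proof -
    have "N s \<le> N t" unfolding N_def
    proof (intro nn_integral_mono)
      fix x :: real
      show "ennreal (- f x) * ennreal (exp (- (s * x))) \<le> ennreal (- f x) * ennreal (exp (- (t * x)))"
        using that f0[of x] by (cases "x \<le> 0") (auto intro!: mult_left_mono ennreal_leI mult_right_mono)
    qed
    also have "\<dots> \<le> ennreal (1 - g t)"
    proof -
      have "enn2real (P t) \<le> 1" using P1[of t] that by (simp add: enn2real_leI)
      then show ?thesis using that a N_le(1)[of t] by (simp add: ennreal_leI)
    qed
    finally show ?thesis .
  qed
  have "((\<lambda>t. ennreal (1 - g t)) \<longlongrightarrow> ennreal (1 - 1)) (at_right 0)"
    by (intro tendsto_ennrealI tendsto_intros lim)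
  moreover have "\<forall>\<^sub>F t in at_right 0. N s \<le> ennreal (1 - g t)"
    unfolding eventually_at_right_field using \<open>0 < s\<close> N_small by (auto intro!: exI[of _ s])
  ultimately have "N s \<le> ennreal (1 - 1)"
    by (intro tendsto_lowerbound) auto
  then have "N s = 0" by simp
  then have "enn2real (P s) = g s"
    using N_le[of s] a \<open>0 < s\<close> by (metis diff_ge_0_iff_ge ennreal_eq_0_iff le_iff_diff_le_0 less_imp_le order_antisym)
  moreover have "P s < top" using P1[of s] \<open>0 < s\<close> by (simp add: order_le_less_trans)
  ultimately show ?thesis unfolding P_def[symmetric] by (metis ennreal_enn2real)
qed

text \<open>
  The function \<open>l / (l + z powr \<alpha>)\<close> is holomorphic on the right half-plane because \<open>\<alpha> \<le> 1\<close> keeps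
  \<open>z powr \<alpha>\<close> there. That the density has mass 1 is part of \<open>T\<close> being distributed according to it.
\<close>

lemma mittag_leffler_expectation_exp:
  fixes M :: "'a measure"
  assumes "prob_space M" and \<alpha>: "0 < \<alpha>" "\<alpha> \<le> 1" and l: "0 < l"
    and T: "distributed M lborel T (\<lambda>x. ennreal (mittag_leffler_density \<alpha> l x))" and s: "0 \<le> s"
  shows "(\<integral>\<omega>. exp (- (s * T \<omega>)) \<partial>M) = l / (l + s powr \<alpha>)"
proof (cases "s = 0")
  case True
  interpret prob_space M by fact
  show ?thesis using True l by (simp add: prob_space)
next
  case False
  with s have s: "0 < s" by simp
  interpret prob_space M by fact
  define f where "f = mittag_leffler_density \<alpha> l"
  note T = T[folded f_def]
  have [measurable]: "f \<in> borel_measurable borel"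
    unfolding f_def mittag_leffler_density_def[abs_def] mittag_leffler_def by measurable
  have [measurable]: "T \<in> borel_measurable M" using distributed_measurable[OF T] by simp
  define \<phi> where "\<phi> z = complex_of_real l / (complex_of_real l + z powr complex_of_real \<alpha>)" for z
  have "(\<integral>\<^sup>+x. ennreal (f x) * ennreal (exp (- (s * x))) \<partial>lborel) = ennreal (l / (l + s powr \<alpha>))"
  proof (rule laplace_continuation[where s\<^sub>0="l powr (1 / \<alpha>)" and \<phi>=\<phi> and g="\<lambda>t. l / (l + t powr \<alpha>)"])
    show "f x = 0" if "x \<le> 0" for x using that by (simp add: f_def mittag_leffler_density_def)
    have "(\<integral>\<^sup>+x. ennreal (f x) \<partial>lborel) = emeasure M (space M)"
      using distributed_emeasure[OF T, of UNIV] by simp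
    then show "(\<integral>\<^sup>+x. ennreal (f x) \<partial>lborel) \<le> 1" by (simp add: emeasure_space_1)
    have large: "l < t powr \<alpha>" "0 < t" if "l powr (1 / \<alpha>) < t" for t
    proof -
      show "0 < t" using that by (meson le_less_trans powr_ge_zero)
      have "(l powr (1 / \<alpha>)) powr \<alpha> < t powr \<alpha>" using that \<alpha> by (intro powr_less_mono2) auto
      then show "l < t powr \<alpha>" using \<alpha> l by (simp add: powr_powr)
    qed
    show "integrable lborel (\<lambda>x. f x * exp (- (t * x)))" if "l powr (1 / \<alpha>) < t" for t
      unfolding f_def using mittag_leffler_laplace_large(1)[OF \<alpha>(1) l] large[OF that] by blast
    show "(\<integral>x. f x * exp (- (t * x)) \<partial>lborel) = l / (l + t powr \<alpha>)" if "l powr (1 / \<alpha>) < t" for t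
      unfolding f_def using mittag_leffler_laplace_large(2)[OF \<alpha>(1) l] large[OF that] by blast
    show "\<phi> holomorphic_on {z. 0 < Re z}"
      unfolding \<phi>_def
    proof (intro holomorphic_intros)
      fix z assume z: "z \<in> {z. 0 < Re z}"
      then show "z \<notin> \<real>\<^sub>\<le>\<^sub>0" using complex_nonpos_Reals_iff by auto
      have z0: "z \<noteq> 0" using z by auto
      have "\<bar>Im (Ln z)\<bar> < pi / 2" unfolding Re_Ln_pos_lt[OF z0] using z by simp
      then have "\<bar>\<alpha> * Im (Ln z)\<bar> < pi / 2"
        using \<alpha> mult_right_mono[of \<alpha> 1 "\<bar>Im (Ln z)\<bar>"] by (simp add: abs_mult)
      then have "cos (\<alpha> * Im (Ln z)) > 0" by (intro cos_gt_zero_pi) (auto simp: abs_less_iff)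
      then have "Re (z powr complex_of_real \<alpha>) > 0"
        using z0 by (simp add: powr_def Re_exp)
      then have "Re (complex_of_real l + z powr complex_of_real \<alpha>) > 0" using l by simp
      then show "complex_of_real l + z powr complex_of_real \<alpha> \<noteq> 0" by (metis less_irrefl zero_complex.sel(1))
    qed
    show "\<phi> (of_real t) = of_real (l / (l + t powr \<alpha>))" if "0 < t" for t
      using that by (simp add: \<phi>_def powr_of_real)
    have "((\<lambda>t. l / (l + t powr \<alpha>)) \<longlongrightarrow> l / (l + 0 powr \<alpha>)) (at_right 0)"
      using \<alpha> l by (intro tendsto_intros tendsto_powr') (auto simp: eventually_at_right_field intro!: exI[of _ 1])
    then show "((\<lambda>t. l / (l + t powr \<alpha>)) \<longlongrightarrow> 1) (at_right 0)" using l by simp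
  qed (use s in auto)
  then have "(\<integral>\<^sup>+\<omega>. ennreal (exp (- (s * T \<omega>))) \<partial>M) = ennreal (l / (l + s powr \<alpha>))"
    using distributed_nn_integral[OF T, of "\<lambda>x. ennreal (exp (- (s * x)))"] by simp
  then show ?thesis
    using l by (intro integral_eq_nn_integral[THEN trans]) auto
qed

lemma mittag_leffler_AE_pos:
  assumes T: "distributed M lborel T (\<lambda>x. ennreal (mittag_leffler_density \<alpha> l x))"
  shows "AE \<omega> in M. 0 < T \<omega>"
proof -
  have "AE x in density lborel (\<lambda>x. ennreal (mittag_leffler_density \<alpha> l x)). 0 < x"
    using distributed_borel_measurable[OF T]
    by (subst AE_density) (auto simp: mittag_leffler_density_def)
  then show ?thesis
    unfolding distributed_distr_eq_density[OF T, symmetric]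
    by (subst (asm) AE_distr_iff) (use distributed_measurable[OF T] in auto)
qed

section \<open>Transient states and the killed chain\<close>

lemma stochastic_matrixD:
  assumes "stochastic_matrix Q"
  shows "0 \<le> Q $ i $ j" "(\<Sum>j\<in>UNIV. Q $ i $ j) = 1"
  using assms by (auto simp: stochastic_matrix_def)

lemma sum_option: "(\<Sum>i\<in>UNIV. f i) = f None + (\<Sum>i\<in>UNIV. f (Some i))"
  for f :: "'p::finite option \<Rightarrow> 'b::comm_monoid_add"
  by (simp add: UNIV_option_conv sum.reindex)

lemma stochastic_matrix_absorbingD:
  fixes Q :: "real^'s::finite^'s"
  assumes Q: "stochastic_matrix Q" and i: "absorbing_state Q i" and "j \<noteq> i"
  shows "Q $ i $ j = 0"
proof -
  have "(\<Sum>k\<in>UNIV - {i}. Q $ i $ k) = 0"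
    using stochastic_matrixD(2)[OF Q, of i] i by (simp add: sum.remove[of UNIV i] absorbing_state_def)
  then show ?thesis
    using assms by (subst (asm) sum_nonneg_eq_0_iff) (auto simp: stochastic_matrixD(1))
qed

lemma first_passage_prob_suminf:
  fixes Q :: "real^'s::finite^'s"
  assumes Q: "stochastic_matrix Q"
  shows "(\<Sum>n. first_passage_prob Q j n i) \<le> 1"
    and "(\<Sum>n. first_passage_prob Q j n i) =
      Q $ i $ j + (\<Sum>k\<in>UNIV - {j}. Q $ i $ k * (\<Sum>n. first_passage_prob Q j n k))"
proof -
  have nonneg: "0 \<le> first_passage_prob Q j n i" for n i
    by (induction n arbitrary: i) (auto simp: stochastic_matrixD[OF Q] intro!: sum_nonneg)
  have rec: "(\<Sum>m<Suc n. first_passage_prob Q j m i) =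
      Q $ i $ j + (\<Sum>k\<in>UNIV - {j}. Q $ i $ k * (\<Sum>m<n. first_passage_prob Q j m k))" for n i
    by (subst sum.lessThan_Suc_shift) (simp add: sum_distrib_left sum.swap[of _ "{..<n}"])
  have le1: "(\<Sum>m<n. first_passage_prob Q j m i) \<le> 1" for n i
  proof (induction n arbitrary: i)
    case (Suc n)
    have "(\<Sum>m<Suc n. first_passage_prob Q j m i) \<le> Q $ i $ j + (\<Sum>k\<in>UNIV - {j}. Q $ i $ k * 1)"
      unfolding rec by (intro add_mono sum_mono mult_left_mono Suc) (auto simp: stochastic_matrixD[OF Q])
    also have "\<dots> = 1"
      using stochastic_matrixD(2)[OF Q, of i] by (simp add: sum.remove[of UNIV j])
    finally show ?case .
  qed simp
  have summ: "summable (\<lambda>n. first_passage_prob Q j n i)" for i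
    by (rule summableI_nonneg_bounded[OF nonneg le1])
  show "(\<Sum>n. first_passage_prob Q j n i) \<le> 1"
    by (rule suminf_le_const[OF summ le1])
  have "(\<lambda>n. \<Sum>m<Suc n. first_passage_prob Q j m i) \<longlonglongrightarrow> (\<Sum>n. first_passage_prob Q j n i)"
    by (rule LIMSEQ_Suc[OF summable_LIMSEQ[OF summ]])
  moreover have "(\<lambda>n. \<Sum>m<Suc n. first_passage_prob Q j m i) \<longlonglongrightarrow>
      Q $ i $ j + (\<Sum>k\<in>UNIV - {j}. Q $ i $ k * (\<Sum>n. first_passage_prob Q j n k))"
    unfolding rec by (intro tendsto_intros summable_LIMSEQ[OF summ])
  ultimately show "(\<Sum>n. first_passage_prob Q j n i) =
      Q $ i $ j + (\<Sum>k\<in>UNIV - {j}. Q $ i $ k * (\<Sum>n. first_passage_prob Q j n k))"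
    by (rule LIMSEQ_unique)
qed

definition closed_set :: "real^'s^'s \<Rightarrow> 's set \<Rightarrow> bool" where
  "closed_set Q C \<longleftrightarrow> (\<forall>i\<in>C. \<forall>k. 0 < Q $ i $ k \<longrightarrow> k \<in> C)"

lemma closed_setD: "closed_set Q C \<Longrightarrow> i \<in> C \<Longrightarrow> k \<notin> C \<Longrightarrow> stochastic_matrix Q \<Longrightarrow> Q $ i $ k = 0"
  unfolding closed_set_def by (metis less_eq_real_def stochastic_matrixD(1))

text \<open>
  If \<open>C\<close> were closed and non-empty, pick \<open>j\<close> in \<open>C\<close> and let \<open>h i\<close> be the probability of never
  visiting \<open>j\<close> after time 0 from \<open>i\<close>. It is an average of the values of \<open>h\<close> at the next state, with
  value 0 at \<open>j\<close>. By transience \<open>h j > 0\<close>, so where \<open>h\<close> is maximal on \<open>C\<close> the chain cannot step to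
  \<open>j\<close> and can only step to other maximal points. Hence the set \<open>D\<close> of maximal points without \<open>j\<close>
  is a smaller closed set, and it is non-empty: a contradiction by induction.
\<close>

lemma closed_set_transient_empty:
  fixes Q :: "real^'s::finite^'s"
  assumes Q: "stochastic_matrix Q"
  shows "closed_set Q C \<Longrightarrow> (\<And>i. i \<in> C \<Longrightarrow> transient_state Q i) \<Longrightarrow> C = {}"
proof (induction C rule: finite_psubset_induct[OF finite])
  case (1 C)
  show ?case
  proof (rule ccontr)
    assume "C \<noteq> {}"
    then obtain j where j: "j \<in> C" by blast
    define h where "h i = 1 - (\<Sum>n. first_passage_prob Q j n i)" for i
    have h_nonneg: "0 \<le> h i" for i
      unfolding h_def using first_passage_prob_suminf(1)[OF Q, of j i] by simp
    have h_rec: "h i = (\<Sum>k\<in>UNIV - {j}. Q $ i $ k * h k)" for i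
    proof -
      have "(\<Sum>k\<in>UNIV - {j}. Q $ i $ k * h k) =
          (\<Sum>k\<in>UNIV - {j}. Q $ i $ k) - (\<Sum>k\<in>UNIV - {j}. Q $ i $ k * (\<Sum>n. first_passage_prob Q j n k))"
        by (simp add: h_def right_diff_distrib sum_subtractf)
      moreover have "(\<Sum>k\<in>UNIV - {j}. Q $ i $ k) = 1 - Q $ i $ j"
        using stochastic_matrixD(2)[OF Q, of i] by (simp add: sum.remove[of UNIV j])
      ultimately show ?thesis
        using first_passage_prob_suminf(2)[OF Q, of j i] by (simp add: h_def)
    qed
    define m where "m = Max (h ` C)"
    define D where "D = {i \<in> C. h i = m}"
    have h_le: "h i \<le> m" if "i \<in> C" for i using that by (simp add: m_def)
    have m_pos: "0 < m"
      using h_le[OF j] 1(4)[OF j] by (simp add: h_def transient_state_def)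
    have "m \<in> h ` C" unfolding m_def using j by (intro Max_in) auto
    then have D_ne: "D \<noteq> {}" by (auto simp: D_def)
    have step: "Q $ i $ j = 0 \<and> (\<forall>k. 0 < Q $ i $ k \<longrightarrow> k \<in> D)" if i: "i \<in> D" for i
    proof -
      have iC: "i \<in> C" and hi: "h i = m" using i by (auto simp: D_def)
      define e where "e k = (if k = j then Q $ i $ k * m else Q $ i $ k * (m - h k))" for k
      have e_nonneg: "0 \<le> e k" for k
        using closed_setD[OF 1(3) iC _ Q, of k] h_le[of k] m_pos stochastic_matrixD(1)[OF Q, of i k]
        by (cases "k \<in> C") (auto simp: e_def)
      have "(\<Sum>k\<in>UNIV. e k) = Q $ i $ j * m + (\<Sum>k\<in>UNIV - {j}. Q $ i $ k * (m - h k))"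
        by (simp add: sum.remove[of UNIV j] e_def)
      also have "\<dots> = (\<Sum>k\<in>UNIV. Q $ i $ k) * m - h i"
        unfolding h_rec[of i]
        by (simp add: sum.remove[of UNIV j] right_diff_distrib sum_subtractf sum_distrib_right distrib_right)
      also have "\<dots> = 0" using stochastic_matrixD(2)[OF Q, of i] hi by simp
      finally have e0: "e k = 0" for k
        using e_nonneg by (simp add: sum_nonneg_eq_0_iff)
      have Qj: "Q $ i $ j = 0" using e0[of j] m_pos by (simp add: e_def)
      have "k \<in> D" if "0 < Q $ i $ k" for k
      proof -
        have "k \<noteq> j" using that Qj by auto
        moreover have "k \<in> C" using closed_setD[OF 1(3) iC _ Q, of k] that by auto
        ultimately show ?thesis using e0[of k] that by (auto simp: e_def D_def)
      qed
      with Qj show ?thesis by blast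
    qed
    have "closed_set Q (D - {j})"
      unfolding closed_set_def using step by (metis DiffD1 Diff_iff less_irrefl singletonD)
    moreover have "D - {j} \<subset> C" using j by (auto simp: D_def)
    moreover have "transient_state Q i" if "i \<in> D - {j}" for i using that 1(4) by (auto simp: D_def)
    ultimately have "D - {j} = {}" using 1(2) by blast
    moreover obtain i where i: "i \<in> D" using D_ne by blast
    moreover have "\<exists>k. 0 < Q $ i $ k"
      using stochastic_matrixD[OF Q, of i]
      by (metis less_eq_real_def sum.neutral zero_neq_one)
    ultimately show False using step[OF i] by force
  qed
qed

text \<open>
  One step of the chain, killed on leaving \<open>i\<close> with probability \<open>1 - \<phi> i\<close>.
\<close>

definition weighted_step :: "real^'s^'s \<Rightarrow> ('s \<Rightarrow> real) \<Rightarrow> ('s \<Rightarrow> real) \<Rightarrow> 's \<Rightarrow> real" where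
  "weighted_step Q \<phi> f i = \<phi> i * (\<Sum>j\<in>UNIV. Q $ i $ j * f j)"

text \<open>
  A maximum principle: the states where \<open>\<bar>v\<bar>\<close> attains a positive maximum would form a closed set
  avoiding \<open>None\<close>.
\<close>

lemma weighted_step_fixpoint_zero:
  fixes Q :: "real^('p::finite option)^('p option)"
  assumes Q: "stochastic_matrix Q" and tr: "\<And>i. transient_state Q (Some i)"
    and \<phi>: "\<And>i. 0 \<le> \<phi> i" "\<And>i. \<phi> i \<le> 1"
    and v: "weighted_step Q \<phi> v = v" and None: "v None = 0"
  shows "v i = 0"
proof -
  define m where "m = Max (range (\<lambda>i. \<bar>v i\<bar>))"
  define C where "C = {i. \<bar>v i\<bar> = m}"
  have le: "\<bar>v i\<bar> \<le> m" for i by (simp add: m_def)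
  have "m \<le> 0"
  proof (rule ccontr)
    assume "\<not> m \<le> 0"
    then have m: "0 < m" by simp
    have "m \<in> range (\<lambda>i. \<bar>v i\<bar>)" unfolding m_def by (intro Max_in) auto
    then have "C \<noteq> {}" by (auto simp: C_def)
    moreover have "closed_set Q C"
      unfolding closed_set_def
    proof safe
      fix i k assume i: "i \<in> C" and k: "0 < Q $ i $ k"
      have "m = \<bar>weighted_step Q \<phi> v i\<bar>" using i v by (simp add: C_def)
      also have "\<dots> = \<phi> i * \<bar>\<Sum>j\<in>UNIV. Q $ i $ j * v j\<bar>" using \<phi> by (simp add: weighted_step_def abs_mult)
      also have "\<dots> \<le> 1 * \<bar>\<Sum>j\<in>UNIV. Q $ i $ j * v j\<bar>" using \<phi> by (intro mult_right_mono) auto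
      also have "\<dots> \<le> (\<Sum>j\<in>UNIV. Q $ i $ j * \<bar>v j\<bar>)"
        using stochastic_matrixD(1)[OF Q] by (auto simp: abs_mult intro!: order_trans[OF sum_abs])
      finally have "(\<Sum>j\<in>UNIV. Q $ i $ j * (m - \<bar>v j\<bar>)) \<le> 0"
        using stochastic_matrixD(2)[OF Q, of i]
        by (simp add: right_diff_distrib sum_subtractf sum_distrib_right[symmetric])
      moreover have nn: "0 \<le> Q $ i $ j * (m - \<bar>v j\<bar>)" for j
        using stochastic_matrixD(1)[OF Q] le[of j] by simp
      ultimately have "(\<Sum>j\<in>UNIV. Q $ i $ j * (m - \<bar>v j\<bar>)) = 0"
        by (intro antisym sum_nonneg) auto
      then have "Q $ i $ k * (m - \<bar>v k\<bar>) = 0" using nn by (simp add: sum_nonneg_eq_0_iff)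
      then show "k \<in> C" using k by (auto simp: C_def)
    qed
    moreover have "transient_state Q i" if "i \<in> C" for i
      using that None m tr by (cases i) (auto simp: C_def)
    ultimately show False using closed_set_transient_empty[OF Q] by blast
  qed
  then show ?thesis using le[of i] by simp
qed

text \<open>
  The iterates decrease to some fixed point with the boundary value \<open>f None\<close>, and there is only one.
\<close>

lemma weighted_step_iterates_tendsto:
  fixes Q :: "real^('p::finite option)^('p option)"
  assumes Q: "stochastic_matrix Q" and tr: "\<And>i. transient_state Q (Some i)"
    and abs: "absorbing_state Q None"
    and \<phi>: "\<And>i. 0 \<le> \<phi> i" "\<And>i. \<phi> i \<le> 1" "\<phi> None = 1"
    and f: "\<And>i. 0 \<le> f i" "\<And>i. weighted_step Q \<phi> f i \<le> f i"
    and w: "weighted_step Q \<phi> w = w" "w None = f None"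
  shows "(\<lambda>n. (weighted_step Q \<phi> ^^ n) f i) \<longlonglongrightarrow> w i"
proof -
  define g where "g n = (weighted_step Q \<phi> ^^ n) f" for n
  have gS: "g (Suc n) = weighted_step Q \<phi> (g n)" for n by (simp add: g_def)
  have mono: "weighted_step Q \<phi> u i \<le> weighted_step Q \<phi> u' i" if "\<And>i. u i \<le> u' i" for u u' i
    unfolding weighted_step_def
    by (intro mult_left_mono sum_mono that \<phi> stochastic_matrixD(1)[OF Q])
  have g_nonneg: "0 \<le> g n i" for n i
    by (induction n arbitrary: i)
       (auto simp: g_def weighted_step_def f intro!: mult_nonneg_nonneg sum_nonneg \<phi> stochastic_matrixD(1)[OF Q])
  have dec: "g (Suc n) i \<le> g n i" for n i
  proof (induction n arbitrary: i)
    case 0 show ?case using f by (simp add: g_def)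
  next
    case (Suc n) show ?case unfolding gS[of "Suc n"] gS[of n] by (rule mono) (use Suc gS in auto)
  qed
  have "convergent (\<lambda>n. g n i)" for i
  proof -
    have "decseq (\<lambda>n. g n i)" using dec by (rule decseq_SucI)
    then show ?thesis using decseq_convergent[of "\<lambda>n. g n i" 0] g_nonneg by (metis convergentI)
  qed
  then have lim: "(\<lambda>n. g n i) \<longlonglongrightarrow> lim (\<lambda>n. g n i)" for i
    by (rule convergent_LIMSEQ_iff[THEN iffD1])
  define u where "u i = lim (\<lambda>n. g n i)" for i
  note lim = lim[folded u_def]
  have u_fix: "weighted_step Q \<phi> u = u"
  proof
    fix i
    have "(\<lambda>n. g (Suc n) i) \<longlonglongrightarrow> weighted_step Q \<phi> u i"
      unfolding gS weighted_step_def by (intro tendsto_intros lim)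
    then show "weighted_step Q \<phi> u i = u i"
      using LIMSEQ_Suc[OF lim] LIMSEQ_unique by blast
  qed
  have "g n None = f None" for n
  proof (induction n)
    case (Suc n)
    have "Q $ None $ None = 1" using abs by (simp add: absorbing_state_def)
    then show ?case
      using Suc stochastic_matrix_absorbingD[OF Q abs] \<phi> by (simp add: gS weighted_step_def sum_option)
  qed (simp add: g_def)
  then have u_None: "u None = f None" using lim[of None] by (simp add: LIMSEQ_const_iff)
  have "weighted_step Q \<phi> (\<lambda>i. u i - w i) = (\<lambda>i. u i - w i)"
  proof
    fix i
    have "weighted_step Q \<phi> (\<lambda>i. u i - w i) i = weighted_step Q \<phi> u i - weighted_step Q \<phi> w i"
      by (simp add: weighted_step_def right_diff_distrib sum_subtractf)
    then show "weighted_step Q \<phi> (\<lambda>i. u i - w i) i = u i - w i" by (simp add: u_fix w)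
  qed
  then have "u i - w i = 0"
    by (rule weighted_step_fixpoint_zero[OF Q tr \<phi>(1,2)]) (simp add: u_None w)
  then show ?thesis using lim[of i] by (simp add: g_def)
qed

section \<open>Expectations along a Markov chain\<close>

lemma sum_histories:
  fixes g :: "(nat \<Rightarrow> 's::finite) \<Rightarrow> real"
  assumes "\<And>z z'. (\<And>k. k < n \<Longrightarrow> z k = z' k) \<Longrightarrow> g z = g z'"
  shows "g z = (\<Sum>h\<in>Pi\<^sub>E {..<n} (\<lambda>_. UNIV). of_bool (\<forall>k<n. z k = h k) * g h)"
proof -
  have "(\<Sum>h\<in>Pi\<^sub>E {..<n} (\<lambda>_. UNIV). of_bool (\<forall>k<n. z k = h k) * g h) =
      (\<Sum>h\<in>Pi\<^sub>E {..<n} (\<lambda>_. UNIV). if h = restrict z {..<n} then g h else 0)"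
    by (intro sum.cong refl) (auto simp: fun_eq_iff PiE_iff extensional_def)
  also have "\<dots> = g (restrict z {..<n})"
    by (subst sum.delta) (auto intro: finite_PiE)
  also have "\<dots> = g z" by (rule assms) auto
  finally show ?thesis ..
qed

lemma (in prob_space)
  assumes [measurable]: "Measurable.pred M P"
  shows integrable_of_bool: "integrable M (\<lambda>\<omega>. of_bool (P \<omega>) :: real)"
    and expectation_of_bool: "(\<integral>\<omega>. of_bool (P \<omega>) \<partial>M) = \<P>(\<omega> in M. P \<omega>)"
proof -
  have "(\<integral>\<omega>. of_bool (P \<omega>) \<partial>M) = (\<integral>\<omega>. indicator {\<omega> \<in> space M. P \<omega>} \<omega> \<partial>M)"
    by (intro Bochner_Integration.integral_cong) (auto simp: indicator_def)
  also have "\<dots> = measure M {\<omega> \<in> space M. P \<omega>}" by (simp add: Int_absorb2)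
  finally show "(\<integral>\<omega>. of_bool (P \<omega>) \<partial>M) = \<P>(\<omega> in M. P \<omega>)" .
  show "integrable M (\<lambda>\<omega>. of_bool (P \<omega>) :: real)"
    by (intro integrable_const_bound[where B=1]) auto
qed

lemma (in prob_space) expectation_finite_valued:
  fixes u :: "'s::finite \<Rightarrow> real"
  assumes [measurable]: "Y \<in> measurable M (count_space UNIV)"
  shows "(\<integral>\<omega>. u (Y \<omega>) \<partial>M) = (\<Sum>i\<in>UNIV. u i * \<P>(\<omega> in M. Y \<omega> = i))"
proof -
  have "(\<integral>\<omega>. u (Y \<omega>) \<partial>M) = (\<integral>\<omega>. (\<Sum>i\<in>UNIV. u i * of_bool (Y \<omega> = i)) \<partial>M)"
    by (intro Bochner_Integration.integral_cong refl) (simp add: of_bool_def if_distrib cong: if_cong)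
  also have "\<dots> = (\<Sum>i\<in>UNIV. \<integral>\<omega>. u i * of_bool (Y \<omega> = i) \<partial>M)"
    by (intro Bochner_Integration.integral_sum integrable_mult_right integrable_of_bool) measurable
  also have "\<dots> = (\<Sum>i\<in>UNIV. u i * \<P>(\<omega> in M. Y \<omega> = i))"
    by (simp add: expectation_of_bool)
  finally show ?thesis .
qed

text \<open>
  The definition of a Markov chain speaks about single histories; this is the Markov property for
  functions of the past, obtained by summing over the finitely many histories.
\<close>

lemma markov_chain_step:
  fixes Q :: "real^'s::finite^'s" and g :: "(nat \<Rightarrow> 's) \<Rightarrow> real"
  assumes "prob_space M" and mc: "markov_chain M Q Z"
    and dep: "\<And>z z'. (\<And>k. k < Suc n \<Longrightarrow> z k = z' k) \<Longrightarrow> g z = g z'"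
  shows "(\<integral>\<omega>. g (\<lambda>k. Z k \<omega>) * f (Z (Suc n) \<omega>) \<partial>M) =
    (\<integral>\<omega>. g (\<lambda>k. Z k \<omega>) * (\<Sum>j\<in>UNIV. Q $ Z n \<omega> $ j * f j) \<partial>M)"
proof -
  interpret prob_space M by fact
  have [measurable]: "Z k \<in> measurable M (count_space UNIV)" for k
    using mc by (simp add: markov_chain_def)
  define hist where "hist h \<omega> \<longleftrightarrow> (\<forall>k<Suc n. Z k \<omega> = h k)" for h \<omega>
  have [measurable]: "Measurable.pred M (hist h)" for h unfolding hist_def by measurable
  let ?H = "Pi\<^sub>E {..<Suc n} (\<lambda>_. UNIV :: 's set)"
  have g_eq: "g (\<lambda>k. Z k \<omega>) = (\<Sum>h\<in>?H. of_bool (hist h \<omega>) * g h)" for \<omega>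
    unfolding hist_def by (rule sum_histories[OF dep])
  have prob_step: "\<P>(\<omega> in M. hist h \<omega> \<and> Z (Suc n) \<omega> = j) = \<P>(\<omega> in M. hist h \<omega>) * Q $ h n $ j" for h j
  proof (cases "\<P>(\<omega> in M. hist h \<omega>) > 0")
    case True
    have hist: "(\<forall>k\<le>n. Z k \<omega> = (h(Suc n := j)) k) = hist h \<omega>" for \<omega>
      by (auto simp: hist_def less_Suc_eq_le)
    have "\<P>(\<omega> in M. Z (Suc n) \<omega> = j \<bar> hist h \<omega>) = Q $ h n $ j"
      using mc True unfolding markov_chain_def
      by (auto dest!: spec[of _ n] spec[of _ "h(Suc n := j)"] simp: hist[simplified])
    then show ?thesis using True by (simp add: cond_prob_def field_simps conj_commute)
  next
    case False
    then have "\<P>(\<omega> in M. hist h \<omega>) = 0" by (simp add: less_le)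
    moreover have "\<P>(\<omega> in M. hist h \<omega> \<and> Z (Suc n) \<omega> = j) \<le> \<P>(\<omega> in M. hist h \<omega>)"
      by (intro finite_measure_mono) auto
    ultimately show ?thesis by (simp add: antisym)
  qed
  note ob = expectation_of_bool integrable_of_bool
  have "(\<integral>\<omega>. g (\<lambda>k. Z k \<omega>) * f (Z (Suc n) \<omega>) \<partial>M) =
      (\<integral>\<omega>. (\<Sum>h\<in>?H. \<Sum>j\<in>UNIV. g h * f j * of_bool (hist h \<omega> \<and> Z (Suc n) \<omega> = j)) \<partial>M)"
  proof (intro Bochner_Integration.integral_cong refl)
    fix \<omega>
    have "f (Z (Suc n) \<omega>) = (\<Sum>j\<in>UNIV. of_bool (Z (Suc n) \<omega> = j) * f j)"
      by (simp add: of_bool_def if_distrib[of "\<lambda>x. x * _"] cong: if_cong)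
    from arg_cong2[where f="(*)", OF g_eq[of \<omega>] this]
    show "g (\<lambda>k. Z k \<omega>) * f (Z (Suc n) \<omega>) =
       (\<Sum>h\<in>?H. \<Sum>j\<in>UNIV. g h * f j * of_bool (hist h \<omega> \<and> Z (Suc n) \<omega> = j))"
      by (simp only: sum_product of_bool_conj mult_ac) (rule sum.swap)
  qed
  also have "\<dots> = (\<Sum>h\<in>?H. \<Sum>j\<in>UNIV. g h * f j * \<P>(\<omega> in M. hist h \<omega> \<and> Z (Suc n) \<omega> = j))"
    by (simp add: ob del: sum_mult_of_bool_eq sum_of_bool_mult_eq)
  also have "\<dots> = (\<Sum>h\<in>?H. (g h * (\<Sum>j\<in>UNIV. Q $ h n $ j * f j)) * \<P>(\<omega> in M. hist h \<omega>))"
    by (simp add: prob_step sum_distrib_left sum_distrib_right mult_ac)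
  also have "\<dots> = (\<integral>\<omega>. (\<Sum>h\<in>?H. (g h * (\<Sum>j\<in>UNIV. Q $ h n $ j * f j)) * of_bool (hist h \<omega>)) \<partial>M)"
    by (simp add: ob del: sum_mult_of_bool_eq sum_of_bool_mult_eq)
  also have "\<dots> = (\<integral>\<omega>. g (\<lambda>k. Z k \<omega>) * (\<Sum>j\<in>UNIV. Q $ Z n \<omega> $ j * f j) \<partial>M)"
    unfolding g_eq sum_distrib_right
    by (intro Bochner_Integration.integral_cong refl sum.cong) (auto simp: hist_def)
  finally show ?thesis .
qed

lemma markov_chain_expectation_prod:
  fixes Q :: "real^'s::finite^'s"
  assumes "prob_space M" and mc: "markov_chain M Q Z"
  shows "(\<integral>\<omega>. (\<Prod>m<n. \<phi> (Z m \<omega>)) * f (Z n \<omega>) \<partial>M) =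
    (\<integral>\<omega>. (weighted_step Q \<phi> ^^ n) f (Z 0 \<omega>) \<partial>M)"
proof (induction n arbitrary: f)
  case (Suc n)
  have "(\<integral>\<omega>. (\<Prod>m<Suc n. \<phi> (Z m \<omega>)) * f (Z (Suc n) \<omega>) \<partial>M) =
     (\<integral>\<omega>. (\<Prod>m<Suc n. \<phi> (Z m \<omega>)) * (\<Sum>j\<in>UNIV. Q $ Z n \<omega> $ j * f j) \<partial>M)"
    by (rule markov_chain_step[OF assms, where g="\<lambda>z. \<Prod>m<Suc n. \<phi> (z m)"])
       (intro prod.cong; simp)
  also have "\<dots> = (\<integral>\<omega>. (\<Prod>m<n. \<phi> (Z m \<omega>)) * weighted_step Q \<phi> f (Z n \<omega>) \<partial>M)"
    by (simp add: weighted_step_def mult.assoc)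
  also have "\<dots> = (\<integral>\<omega>. (weighted_step Q \<phi> ^^ Suc n) f (Z 0 \<omega>) \<partial>M)"
    unfolding Suc by (simp add: funpow_swap1)
  finally show ?case .
qed simp

lemma markov_chain_stays_absorbed:
  fixes Q :: "real^'s::finite^'s"
  assumes "prob_space M" and mc: "markov_chain M Q Z" and abs: "absorbing_state Q i"
  shows "AE \<omega> in M. Z n \<omega> = i \<longrightarrow> Z (Suc n) \<omega> = i"
proof -
  interpret prob_space M by fact
  have [measurable]: "Z k \<in> measurable M (count_space UNIV)" for k
    using mc by (simp add: markov_chain_def)
  have Q: "stochastic_matrix Q" using mc by (simp add: markov_chain_def)
  let ?Y = "\<lambda>\<omega>. of_bool (Z n \<omega> = i) * of_bool (Z (Suc n) \<omega> \<noteq> i) :: real"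
  have "integral\<^sup>L M ?Y =
    (\<integral>\<omega>. of_bool (Z n \<omega> = i) * (\<Sum>j\<in>UNIV. Q $ Z n \<omega> $ j * of_bool (j \<noteq> i)) \<partial>M)"
    by (rule markov_chain_step[OF assms(1,2), where g="\<lambda>z. of_bool (z n = i)"]) simp
  also have "\<dots> = (\<integral>\<omega>. 0 \<partial>M)"
    using stochastic_matrix_absorbingD[OF Q abs]
    by (intro Bochner_Integration.integral_cong) (auto intro!: sum.neutral)
  finally have "integral\<^sup>L M ?Y = 0" by simp
  then have "AE \<omega> in M. ?Y \<omega> = 0"
    by (subst (asm) integral_nonneg_eq_0_iff_AE) (auto intro!: integrable_const_bound[where B=1])
  then show ?thesis by (rule eventually_mono) auto
qed

text \<open>
  The probabilities of not being absorbed at time \<open>n\<close> are given by the iterates of the unkilled chain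
  on the indicator of the transient states, whose limit is the fixed point with value 0 at \<open>None\<close>.
\<close>

lemma markov_chain_absorbed_AE:
  fixes Q :: "real^('p::finite option)^('p option)"
  assumes "prob_space M" and mc: "markov_chain M Q Z"
    and abs: "absorbing_state Q None" and tr: "\<And>i. transient_state Q (Some i)"
  shows "AE \<omega> in M. \<exists>n. Z n \<omega> = None"
proof -
  interpret prob_space M by fact
  have [measurable]: "Z k \<in> measurable M (count_space UNIV)" for k
    using mc by (simp add: markov_chain_def)
  have Q: "stochastic_matrix Q" using mc by (simp add: markov_chain_def)
  let ?f = "\<lambda>i :: 'p option. of_bool (i \<noteq> None) :: real" and ?B = "weighted_step Q (\<lambda>_. 1)"
  have lim: "(\<lambda>n. (?B ^^ n) ?f i) \<longlonglongrightarrow> 0" for i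
  proof (rule weighted_step_iterates_tendsto[OF Q tr abs, where w="\<lambda>_. 0"])
    show "?B ?f j \<le> ?f j" for j
    proof (cases j)
      case None
      then show ?thesis using stochastic_matrix_absorbingD[OF Q abs] by (simp add: weighted_step_def sum_option)
    next
      case (Some k)
      have "(\<Sum>j'\<in>UNIV. Q $ j $ j' * ?f j') \<le> (\<Sum>j'\<in>UNIV. Q $ j $ j')"
        using stochastic_matrixD(1)[OF Q] by (intro sum_mono) auto
      then show ?thesis using Some stochastic_matrixD(2)[OF Q] by (simp add: weighted_step_def)
    qed
  qed (auto simp: weighted_step_def)
  have "(\<lambda>n. \<integral>\<omega>. (?B ^^ n) ?f (Z 0 \<omega>) \<partial>M) \<longlonglongrightarrow> 0"
  proof -
    have "(\<lambda>n. \<Sum>i\<in>UNIV. (?B ^^ n) ?f i * \<P>(\<omega> in M. Z 0 \<omega> = i)) \<longlonglongrightarrow> (\<Sum>i\<in>UNIV. 0 * \<P>(\<omega> in M. Z 0 \<omega> = i))"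
      by (intro tendsto_intros lim)
    then show ?thesis by (simp add: expectation_finite_valued)
  qed
  moreover have "(\<integral>\<omega>. (?B ^^ n) ?f (Z 0 \<omega>) \<partial>M) = (\<integral>\<omega>. ?f (Z n \<omega>) \<partial>M)" for n
    using markov_chain_expectation_prod[OF assms(1,2), where \<phi>="\<lambda>_. 1" and f="?f" and n=n] by simp
  ultimately have lim0: "(\<lambda>n. \<integral>\<omega>. ?f (Z n \<omega>) \<partial>M) \<longlonglongrightarrow> 0" by simp
  let ?Y = "\<lambda>\<omega>. of_bool (\<forall>n. Z n \<omega> \<noteq> None) :: real"
  have int: "integrable M ?Y" by (intro integrable_const_bound[where B=1]) auto
  have "integral\<^sup>L M ?Y \<le> 0"
    by (rule LIMSEQ_le_const[OF lim0])
       (auto intro!: exI[of _ 0] integral_mono int integrable_const_bound[where B=1])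
  then have "integral\<^sup>L M ?Y = 0" by (intro antisym integral_nonneg) auto
  then have "AE \<omega> in M. ?Y \<omega> = 0"
    using int by (subst (asm) integral_nonneg_eq_0_iff_AE) auto
  then show ?thesis by (rule eventually_mono) auto
qed

section \<open>Independent sojourn times along a chain\<close>

lemma (in prob_space) indep_var_vimage_algebra:
  assumes indep: "indep_set (sets (vimage_algebra (space M) X N)) (sets (vimage_algebra (space M) Y L))"
    and X: "X \<in> measurable M N" and Y: "Y \<in> measurable M L"
    and f: "f \<in> measurable N K" and g: "g \<in> measurable L K'"
  shows "indep_var K (\<lambda>\<omega>. f (X \<omega>)) K' (\<lambda>\<omega>. g (Y \<omega>))"
proof -
  have sub: "sigma_sets (space M) {(\<lambda>\<omega>. u (V \<omega>)) -` A \<inter> space M |A. A \<in> sets B} \<subseteq> sets (vimage_algebra (space M) V C)"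
    if "V \<in> measurable M C" "u \<in> measurable C B" for u V B C
  proof -
    have "(\<lambda>\<omega>. u (V \<omega>)) \<in> measurable (vimage_algebra (space M) V C) B"
      by (rule measurable_compose[OF measurable_vimage_algebra1 that(2)]) (use that(1) in \<open>auto simp: measurable_def\<close>)
    then have "{(\<lambda>\<omega>. u (V \<omega>)) -` A \<inter> space M |A. A \<in> sets B} \<subseteq> sets (vimage_algebra (space M) V C)"
      by (auto dest: measurable_sets)
    from sets.sigma_sets_subset[OF this] show ?thesis by simp
  qed
  show ?thesis
    unfolding indep_var_eq
    using indep sub[OF X f] sub[OF Y g] measurable_compose[OF X f] measurable_compose[OF Y g]
    unfolding indep_sets2_eq by blast
qed

text \<open>
  On each of the finitely many histories \<open>h\<close> the product involves the fixed independent variables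
  \<open>T i m\<close> with \<open>h m = Some i\<close>, which are independent of the event that \<open>Z\<close> follows \<open>h\<close>.
\<close>

lemma expectation_sojourn_product:
  fixes Z :: "nat \<Rightarrow> 'a \<Rightarrow> 'p::finite option" and T :: "'p \<Rightarrow> nat \<Rightarrow> 'a \<Rightarrow> real"
    and f :: "'p \<Rightarrow> real \<Rightarrow> real"
  assumes "prob_space M"
    and Z: "\<And>n. Z n \<in> measurable M (count_space UNIV)"
    and indep: "prob_space.indep_vars M (\<lambda>_. borel) (\<lambda>(i, m). T i m) UNIV"
    and indep_ZT: "prob_space.indep_set M
           (sets (vimage_algebra (space M) (\<lambda>\<omega> n. Z n \<omega>) (Pi\<^sub>M UNIV (\<lambda>_. count_space UNIV))))
           (sets (vimage_algebra (space M) (\<lambda>\<omega> (i, m). T i m \<omega>) (Pi\<^sub>M UNIV (\<lambda>_. borel))))"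
    and f[measurable]: "\<And>i. f i \<in> borel_measurable borel"
    and int: "\<And>i m. integrable M (\<lambda>\<omega>. f i (T i m \<omega>))"
    and c: "\<And>i m. (\<integral>\<omega>. f i (T i m \<omega>) \<partial>M) = c i"
  shows "(\<integral>\<omega>. (\<Prod>m<n. case Z m \<omega> of None \<Rightarrow> 1 | Some i \<Rightarrow> f i (T i m \<omega>)) \<partial>M) =
    (\<integral>\<omega>. (\<Prod>m<n. case Z m \<omega> of None \<Rightarrow> 1 | Some i \<Rightarrow> c i) \<partial>M)"
proof -
  interpret prob_space M by fact
  note Z[measurable]
  let ?H = "Pi\<^sub>E {..<n} (\<lambda>_. UNIV :: 'p option set)" and ?I = "UNIV \<times> {..<n} :: ('p \<times> nat) set"
  define A where "A h z \<longleftrightarrow> (\<forall>k<n. z k = h k)" for h z :: "nat \<Rightarrow> 'p option"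
  \<comment> \<open>Padding with factors 1 turns the product along \<open>h\<close> into one over an index set independent of \<open>h\<close>.\<close>
  define F where "F h t = (\<Prod>p\<in>?I. if h (snd p) = Some (fst p) then f (fst p) (t p) else 1)"
    for h :: "nat \<Rightarrow> 'p option" and t :: "'p \<times> nat \<Rightarrow> real"
  define G where "G h = (\<Prod>m<n. case h m of None \<Rightarrow> 1 | Some i \<Rightarrow> c i)" for h :: "nat \<Rightarrow> 'p option"
  have prod_eq: "(\<Prod>p\<in>?I. if h (snd p) = Some (fst p) then w (fst p) (snd p) else 1) =
      (\<Prod>m<n. case h m of None \<Rightarrow> 1 | Some i \<Rightarrow> w i m)" for h :: "nat \<Rightarrow> 'p option" and w :: "'p \<Rightarrow> nat \<Rightarrow> real"
  proof -
    have "(\<Prod>p\<in>?I. if h (snd p) = Some (fst p) then w (fst p) (snd p) else 1) =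
       (\<Prod>i\<in>UNIV. \<Prod>m<n. if h m = Some i then w i m else 1)"
      by (simp add: prod.cartesian_product case_prod_beta)
    also have "\<dots> = (\<Prod>m<n. \<Prod>i\<in>UNIV. if h m = Some i then w i m else 1)"
      by (rule prod.swap)
    also have "\<dots> = (\<Prod>m<n. case h m of None \<Rightarrow> 1 | Some i \<Rightarrow> w i m)"
      by (intro prod.cong refl) (auto split: option.split)
    finally show ?thesis .
  qed
  have A_meas: "(\<lambda>z. of_bool (A h z) :: real) \<in> borel_measurable (Pi\<^sub>M UNIV (\<lambda>_. count_space UNIV))" for h
    unfolding A_def by measurable
  have F_meas: "F h \<in> borel_measurable (Pi\<^sub>M UNIV (\<lambda>_. borel))" for h
    unfolding F_def
    by (intro borel_measurable_prod) (simp add: measurable_compose[where g="f _" and N=borel])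
  have T[measurable]: "T i m \<in> borel_measurable M" for i m
    using indep unfolding indep_vars_def by (auto dest!: bspec[of _ _ "(i, m)"])
  have TT: "(\<lambda>\<omega> (i, m). T i m \<omega>) \<in> measurable M (Pi\<^sub>M UNIV (\<lambda>_. borel))"
    by (rule measurable_PiM_single') (auto simp: case_prod_beta)
  have ZZ: "(\<lambda>\<omega> n. Z n \<omega>) \<in> measurable M (Pi\<^sub>M UNIV (\<lambda>_. count_space UNIV))"
    by (rule measurable_PiM_single') auto
  have int_A: "integrable M (\<lambda>\<omega>. of_bool (A h (\<lambda>n. Z n \<omega>)) :: real)" for h
    unfolding A_def by (intro integrable_of_bool) measurable
  have fT: "indep_vars (\<lambda>_. borel) (\<lambda>p \<omega>. if h (snd p) = Some (fst p) then f (fst p) (T (fst p) (snd p) \<omega>) else 1) ?I"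
    for h :: "nat \<Rightarrow> 'p option"
  proof -
    have "indep_vars (\<lambda>_. borel) (\<lambda>p \<omega>. (\<lambda>x. if h (snd p) = Some (fst p) then f (fst p) x else 1) ((\<lambda>(i, m). T i m) p \<omega>)) ?I"
      by (rule indep_vars_compose2[OF indep_vars_subset[OF indep]]) auto
    then show ?thesis unfolding case_prod_beta .
  qed
  have int_F: "integrable M (\<lambda>\<omega>. F h (\<lambda>(i, m). T i m \<omega>))"
    and val_F: "(\<integral>\<omega>. F h (\<lambda>(i, m). T i m \<omega>) \<partial>M) = G h" for h
  proof -
    have i: "integrable M (\<lambda>\<omega>. if h (snd p) = Some (fst p) then f (fst p) (T (fst p) (snd p) \<omega>) else 1)" for p
      by (cases "h (snd p) = Some (fst p)") (simp_all add: int)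
    show "integrable M (\<lambda>\<omega>. F h (\<lambda>(i, m). T i m \<omega>))"
      unfolding F_def case_prod_beta using indep_vars_integrable[OF _ fT i] by simp
    have "(\<integral>\<omega>. F h (\<lambda>(i, m). T i m \<omega>) \<partial>M) =
       (\<Prod>p\<in>?I. \<integral>\<omega>. (if h (snd p) = Some (fst p) then f (fst p) (T (fst p) (snd p) \<omega>) else 1) \<partial>M)"
      unfolding F_def case_prod_beta using indep_vars_lebesgue_integral[OF _ fT i] by simp
    also have "\<dots> = (\<Prod>p\<in>?I. if h (snd p) = Some (fst p) then (\<lambda>i m. c i) (fst p) (snd p) else 1)"
      by (intro prod.cong refl) (auto simp: c prob_space)
    finally show "(\<integral>\<omega>. F h (\<lambda>(i, m). T i m \<omega>) \<partial>M) = G h"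
      unfolding G_def using prod_eq[of h "\<lambda>i m. c i"] by simp
  qed
  have iv: "indep_var borel (\<lambda>\<omega>. of_bool (A h (\<lambda>n. Z n \<omega>)) :: real) borel (\<lambda>\<omega>. F h (\<lambda>(i, m). T i m \<omega>))" for h
    by (rule indep_var_vimage_algebra[OF indep_ZT ZZ TT A_meas F_meas])
  have split: "(\<Prod>m<n. case z m of None \<Rightarrow> 1 | Some i \<Rightarrow> w i m) =
     (\<Sum>h\<in>?H. of_bool (A h z) * (\<Prod>m<n. case h m of None \<Rightarrow> 1 | Some i \<Rightarrow> w i m))" for z and w :: "'p \<Rightarrow> nat \<Rightarrow> real"
    unfolding A_def by (rule sum_histories[where g="\<lambda>z. \<Prod>m<n. case z m of None \<Rightarrow> 1 | Some i \<Rightarrow> w i m"]) auto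
  have F_eq: "F h (\<lambda>(i, m). T i m \<omega>) = (\<Prod>m<n. case h m of None \<Rightarrow> 1 | Some i \<Rightarrow> f i (T i m \<omega>))" for h \<omega>
    unfolding F_def case_prod_beta by (rule prod_eq)
  have "(\<integral>\<omega>. (\<Prod>m<n. case Z m \<omega> of None \<Rightarrow> 1 | Some i \<Rightarrow> f i (T i m \<omega>)) \<partial>M) =
      (\<integral>\<omega>. (\<Sum>h\<in>?H. of_bool (A h (\<lambda>n. Z n \<omega>)) * F h (\<lambda>(i, m). T i m \<omega>)) \<partial>M)"
    by (intro Bochner_Integration.integral_cong refl) (subst split, simp only: F_eq)
  also have "\<dots> = (\<Sum>h\<in>?H. \<integral>\<omega>. of_bool (A h (\<lambda>n. Z n \<omega>)) * F h (\<lambda>(i, m). T i m \<omega>) \<partial>M)"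
    by (intro Bochner_Integration.integral_sum indep_var_integrable[OF iv int_A int_F])
  also have "\<dots> = (\<Sum>h\<in>?H. (\<integral>\<omega>. of_bool (A h (\<lambda>n. Z n \<omega>)) \<partial>M) * G h)"
    by (simp only: indep_var_lebesgue_integral[OF iv int_A int_F] val_F)
  also have "\<dots> = (\<integral>\<omega>. (\<Sum>h\<in>?H. of_bool (A h (\<lambda>n. Z n \<omega>)) * G h) \<partial>M)"
    using int_A by (subst Bochner_Integration.integral_sum) auto
  also have "\<dots> = (\<integral>\<omega>. (\<Prod>m<n. case Z m \<omega> of None \<Rightarrow> 1 | Some i \<Rightarrow> c i) \<partial>M)"
    unfolding G_def by (intro Bochner_Integration.integral_cong refl) (rule split[symmetric])
  finally show ?thesis .
qed

section \<open>The paths of the semi-Markov process\<close>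

text \<open>
  On a path with positive sojourn times that is absorbed at step \<open>N\<close>, the process runs through the
  states \<open>Z 0, \<dots>, Z (N - 1)\<close> on the consecutive intervals \<open>[S m, S (m + 1))\<close> and sits in \<open>None\<close>
  from \<open>S N\<close> on; integrating over these intervals turns the reward into a finite sum.
\<close>

lemma total_reward_eq:
  fixes Z :: "nat \<Rightarrow> 'a \<Rightarrow> 'p::finite option" and T :: "'p \<Rightarrow> nat \<Rightarrow> 'a \<Rightarrow> real"
  assumes pos: "\<And>i m. 0 < T i m \<omega>" and N: "Z N \<omega> = None" and before: "\<And>m. m < N \<Longrightarrow> Z m \<omega> \<noteq> None"
  shows "total_reward (semi_markov_process Z T) R \<omega> $ k =
    (\<Sum>m<N. case Z m \<omega> of None \<Rightarrow> 0 | Some i \<Rightarrow> R $ i $ k * T i m \<omega>)"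
proof -
  define d where "d m = (case Z m \<omega> of None \<Rightarrow> 0 | Some i \<Rightarrow> T i m \<omega>)" for m
  define S where "S n = (\<Sum>m<n. d m)" for n
  define X where "X = semi_markov_process Z T"
  have soj: "sojourn_time Z T m \<omega> = ereal (d m)" "0 < d m" if "m < N" for m
    using before[OF that] pos by (auto simp: sojourn_time_def d_def)
  have d_nonneg: "0 \<le> d m" for m using pos by (auto simp: d_def less_imp_le split: option.split)
  have S_mono: "S m \<le> S n" if "m \<le> n" for m n
    unfolding S_def using that d_nonneg by (intro sum_mono2) auto
  have S0: "S 0 = 0" by (simp add: S_def)
  have S_Suc: "S (Suc n) = S n + d n" for n by (simp add: S_def)
  have jump: "jump_time Z T n \<omega> = ereal (S n)" if "n \<le> N" for n
    using that by (simp add: jump_time_def S_def soj)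
  have jump_top: "jump_time Z T n \<omega> = \<infinity>" if "N < n" for n
  proof -
    have "jump_time Z T n \<omega> = sojourn_time Z T N \<omega> + (\<Sum>m\<in>{..<n} - {N}. sojourn_time Z T m \<omega>)"
      unfolding jump_time_def using that by (intro sum.remove) auto
    then show ?thesis by (simp add: sojourn_time_def N)
  qed
  have X_eq: "X t \<omega> = Z m \<omega>" if m: "m \<le> N" "S m \<le> t" "m < N \<Longrightarrow> t < S (Suc m)" for m t
  proof -
    have "(LEAST n. jump_time Z T n \<omega> \<le> ereal t \<and> ereal t < jump_time Z T (Suc n) \<omega>) = m"
    proof (rule Least_equality)
      show "jump_time Z T m \<omega> \<le> ereal t \<and> ereal t < jump_time Z T (Suc m) \<omega>"
        using m by (cases "m < N") (auto simp: jump jump_top)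
      fix n assume n: "jump_time Z T n \<omega> \<le> ereal t \<and> ereal t < jump_time Z T (Suc n) \<omega>"
      show "m \<le> n"
      proof (rule ccontr)
        assume "\<not> m \<le> n"
        then have "Suc n \<le> m" by simp
        then have "t < S (Suc n)" "S (Suc n) \<le> S m" using n m jump[of "Suc n"] S_mono[of "Suc n" m] by auto
        then show False using m by simp
      qed
    qed
    then show ?thesis by (simp add: X_def semi_markov_process_def)
  qed
  have between: "X t \<omega> = Z m \<omega>" if "m < N" "S m \<le> t" "t < S (Suc m)" for m t
    using X_eq[of m t] that by simp
  have locate: "\<exists>m<n. S m \<le> t \<and> t < S (Suc m)" if "0 \<le> t" "t < S n" for t n
    using that
  proof (induction n)
    case (Suc n)
    then show ?case by (cases "t < S n") (auto intro: less_SucI)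
  qed (simp add: S0)
  have "{ereal t | t. 0 \<le> t \<and> X t \<omega> = None} = ereal ` {S N..}"
  proof -
    have "X t \<omega> = None \<longleftrightarrow> S N \<le> t" if "0 \<le> t" for t
    proof (cases "S N \<le> t")
      case True then show ?thesis using X_eq[of N t] N by simp
    next
      case False
      then obtain m where "m < N" "S m \<le> t" "t < S (Suc m)" using locate[OF \<open>0 \<le> t\<close>, of N] by auto
      then show ?thesis using between[of m t] before[of m] False by simp
    qed
    moreover have "0 \<le> S N" using S_mono[of 0 N] S0 by simp
    ultimately show ?thesis by force
  qed
  moreover have "Inf (ereal ` {S N..}) = ereal (S N)"
    by (intro antisym Inf_lower Inf_greatest) auto
  ultimately have abs: "absorption_time X \<omega> = ereal (S N)" by (simp add: absorption_time_def)
  define g where "g i = (case i of None \<Rightarrow> 0 | Some i \<Rightarrow> R $ i $ k)" for i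
  have g_eq: "(\<Sum>i\<in>UNIV. R $ i $ k * of_bool (X t \<omega> = Some i)) = g (X t \<omega>)" for t
    by (cases "X t \<omega>") (auto simp: g_def of_bool_def if_distrib cong: if_cong)
  have "has_bochner_integral lborel (\<lambda>t. indicator {0..<S n} t * g (X t \<omega>)) (\<Sum>m<n. g (Z m \<omega>) * d m)" if "n \<le> N" for n
    using that
  proof (induction n)
    case (Suc n)
    have "has_bochner_integral lborel (\<lambda>t. indicator {S n..<S (Suc n)} t * g (Z n \<omega>)) ((S (Suc n) - S n) * g (Z n \<omega>))"
      using has_bochner_integral_mult_left[OF has_bochner_integral_real_indicator[of "{S n..<S (Suc n)}" lborel]] S_mono[of n "Suc n"]
      by (simp add: mult.commute)
    from has_bochner_integral_add[OF Suc.IH[OF Suc_leD[OF Suc.prems]] this]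
    have "has_bochner_integral lborel (\<lambda>t. indicator {0..<S n} t * g (X t \<omega>) + indicator {S n..<S (Suc n)} t * g (Z n \<omega>))
        (\<Sum>m<Suc n. g (Z m \<omega>) * d m)"
      by (simp add: S_Suc mult.commute)
    moreover have "indicator {0..<S n} t * g (X t \<omega>) + indicator {S n..<S (Suc n)} t * g (Z n \<omega>) =
       indicator {0..<S (Suc n)} t * g (X t \<omega>)" for t
      using between[of n t] Suc.prems S_mono[of 0 n] S0 S_mono[of n "Suc n"] by (auto simp: indicator_def)
    ultimately show ?case by simp
  qed (simp add: S0 has_bochner_integral_zero)
  from has_bochner_integral_integral_eq[OF this[of N]]
  have "(\<integral>t. indicator {0..<S N} t * g (X t \<omega>) \<partial>lborel) = (\<Sum>m<N. g (Z m \<omega>) * d m)" by simp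
  moreover have "total_reward X R \<omega> $ k = (\<integral>t. indicator {0..<S N} t * g (X t \<omega>) \<partial>lborel)"
    using S_mono[of 0 N] S0
    unfolding total_reward_def abs zero_ereal_def by (simp only: g_eq vec_lambda_beta interval_integral_Ico set_lebesgue_integral_def real_scaleR_def)
  ultimately have "total_reward X R \<omega> $ k = (\<Sum>m<N. case Z m \<omega> of None \<Rightarrow> 0 | Some i \<Rightarrow> R $ i $ k * T i m \<omega>)"
    unfolding g_def d_def by (simp add: option.case_distrib[of "\<lambda>x. x * _"] cong: option.case_cong)
  then show ?thesis by (simp add: X_def)
qed

lemma semi_markov_process_0:
  assumes pos: "\<And>i m. 0 < T i m \<omega>"
  shows "semi_markov_process Z T 0 \<omega> = Z 0 \<omega>"
proof -
  have "(LEAST n. jump_time Z T n \<omega> \<le> ereal 0 \<and> ereal 0 < jump_time Z T (Suc n) \<omega>) = 0"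
    using pos by (intro Least_equality) (auto simp: jump_time_def sojourn_time_def split: option.split)
  then show ?thesis by (simp add: semi_markov_process_def)
qed

text \<open>
  This holds on every path, even if sojourn times are negative or jump times accumulate: if some
  jump time exceeds \<open>t\<close>, then the index chosen by \<open>LEAST\<close> is the one before the first such jump and
  stays so until that jump; otherwise no index qualifies at any time after \<open>t\<close>, and \<open>LEAST\<close> of an
  empty predicate is a fixed number.
\<close>

lemma semi_markov_process_right_const:
  fixes t :: real
  assumes "0 \<le> t"
  obtains e :: ereal where "ereal t < e"
    "\<And>u. t \<le> u \<Longrightarrow> ereal u < e \<Longrightarrow> semi_markov_process Z T u \<omega> = semi_markov_process Z T t \<omega>"
proof (cases "\<exists>n. ereal t < jump_time Z T (Suc n) \<omega>")
  case True
  define n where "n = (LEAST n. ereal t < jump_time Z T (Suc n) \<omega>)"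
  have n: "ereal t < jump_time Z T (Suc n) \<omega>"
    unfolding n_def using True by (rule LeastI_ex)
  have before: "jump_time Z T (Suc k) \<omega> \<le> ereal t" if "k < n" for k
    using not_less_Least[of k "\<lambda>n. ereal t < jump_time Z T (Suc n) \<omega>"] that by (simp add: n_def)
  have Jn: "jump_time Z T n \<omega> \<le> ereal t"
    using before[of "n - 1"] assms by (cases n) (auto simp: jump_time_def)
  have "(LEAST n. jump_time Z T n \<omega> \<le> ereal u \<and> ereal u < jump_time Z T (Suc n) \<omega>) = n"
    if "t \<le> u" "ereal u < jump_time Z T (Suc n) \<omega>" for u
  proof (rule Least_equality)
    have tu: "ereal t \<le> ereal u" using that by simp
    show "jump_time Z T n \<omega> \<le> ereal u \<and> ereal u < jump_time Z T (Suc n) \<omega>"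
      using Jn that tu order_trans by blast
    fix k assume "jump_time Z T k \<omega> \<le> ereal u \<and> ereal u < jump_time Z T (Suc k) \<omega>"
    then show "n \<le> k" using before[of k] tu by (meson leD leI order_trans)
  qed
  then show thesis
    using n by (intro that[of "jump_time Z T (Suc n) \<omega>"]) (simp_all add: semi_markov_process_def)
next
  case False
  have "\<not> ereal u < jump_time Z T (Suc n) \<omega>" if "t \<le> u" for u n
    using False that by (meson ereal_less_eq(3) leD leI le_less_trans)
  then show thesis
    by (intro that[of \<infinity>]) (simp_all add: semi_markov_process_def)
qed

text \<open>
  Right-continuity reduces the infimum over all times to a countable one, hence to a measurable
  function of the path.
\<close>

lemma absorption_time_semi_markov_process_rat:
  "absorption_time (semi_markov_process Z T) \<omega> =
    (INF q\<in>\<rat> \<inter> {0..}. if semi_markov_process Z T q \<omega> = None then ereal q else \<infinity>)"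
proof (rule antisym)
  let ?X = "\<lambda>t. semi_markov_process Z T t \<omega>"
  let ?G = "INF q\<in>\<rat> \<inter> {0..}. if ?X q = None then ereal q else \<infinity>"
  show "absorption_time (semi_markov_process Z T) \<omega> \<le> ?G"
  proof (intro INF_greatest)
    fix q :: real assume "q \<in> \<rat> \<inter> {0..}"
    then have "0 \<le> q" by simp
    then have "absorption_time (semi_markov_process Z T) \<omega> \<le> ereal q" if "?X q = None"
      unfolding absorption_time_def using that by (intro Inf_lower) blast
    then show "absorption_time (semi_markov_process Z T) \<omega> \<le> (if ?X q = None then ereal q else \<infinity>)"
      by simp
  qed
  have "?G \<le> ereal t" if t: "0 \<le> t" "?X t = None" for t
  proof -
    obtain e where e: "ereal t < e" "\<And>u. t \<le> u \<Longrightarrow> ereal u < e \<Longrightarrow> ?X u = ?X t"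
      by (rule semi_markov_process_right_const[OF t(1), of Z T \<omega>]) (rule that)
    show ?thesis
    proof (rule dense_ge)
      fix y assume "ereal t < y"
      with e(1) have "ereal t < min e y" by simp
      then obtain z where z: "ereal t < ereal z" "ereal z < min e y" using ereal_dense2 by blast
      then obtain q where q: "q \<in> \<rat>" "t < q" "q < z" using Rats_dense_in_real[of t z] by auto
      have q_less: "ereal q < min e y" using less_trans[OF _ z(2), of "ereal q"] q(3) by simp
      then have "?X q = None" using e(2)[of q] q t by simp
      then have "?G \<le> ereal q"
        using q t by (intro INF_lower2[of q]) simp_all
      also have "\<dots> \<le> y" using q_less by (simp add: less_imp_le)
      finally show "?G \<le> y" .
    qed
  qed
  then show "?G \<le> absorption_time (semi_markov_process Z T) \<omega>"
    unfolding absorption_time_def by (intro Inf_greatest) blast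
qed

lemma
  fixes Z :: "nat \<Rightarrow> 'a \<Rightarrow> 'p::finite option"
  assumes Z[measurable]: "\<And>n. Z n \<in> measurable M (count_space UNIV)"
    and T[measurable]: "\<And>i m. T i m \<in> borel_measurable M"
  shows measurable_semi_markov_process_pair:
      "(\<lambda>p. semi_markov_process Z T (snd p) (fst p)) \<in> measurable (M \<Otimes>\<^sub>M borel) (count_space UNIV)"
    and measurable_semi_markov_process: "semi_markov_process Z T t \<in> measurable M (count_space UNIV)"
proof -
  have "sojourn_time Z T m \<in> borel_measurable M" for m
  proof -
    have "(\<lambda>\<omega>. case z of Some i \<Rightarrow> ereal (T i m \<omega>) | None \<Rightarrow> \<infinity>) \<in> borel_measurable M" for z
      by (cases z) auto
    from measurable_compose_countable[OF this Z] show ?thesis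
      by (simp add: sojourn_time_def[abs_def])
  qed
  then have [measurable]: "jump_time Z T n \<in> borel_measurable M" for n
    by (auto simp: jump_time_def[abs_def])
  show X: "(\<lambda>p. semi_markov_process Z T (snd p) (fst p)) \<in> measurable (M \<Otimes>\<^sub>M borel) (count_space UNIV)"
    unfolding semi_markov_process_def
    by (rule measurable_compose_countable[where f="\<lambda>n p. Z n (fst p)"]) measurable
  show "semi_markov_process Z T t \<in> measurable M (count_space UNIV)"
    using measurable_compose[OF _ X, of "\<lambda>\<omega>. (\<omega>, t)"] by simp
qed

text \<open>
  The expectation in the theorem refers to the reward at every point of a space that need not be
  complete, so measurability is required on all paths and not only on the regular ones.
\<close>

lemma borel_measurable_total_reward:
  fixes Z :: "nat \<Rightarrow> 'a \<Rightarrow> 'p::finite option"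
  assumes Z[measurable]: "\<And>n. Z n \<in> measurable M (count_space UNIV)"
    and T[measurable]: "\<And>i m. T i m \<in> borel_measurable M"
  shows "(\<lambda>\<omega>. total_reward (semi_markov_process Z T) R \<omega> $ k) \<in> borel_measurable M"
proof -
  note X[measurable] = measurable_semi_markov_process_pair[OF Z T] and measurable_semi_markov_process[OF Z T, measurable]
  have "absorption_time (semi_markov_process Z T) \<in> borel_measurable M"
    unfolding absorption_time_semi_markov_process_rat[abs_def]
    by (intro borel_measurable_INF) (auto intro: countable_rat)
  note this[measurable]
  have nonneg: "0 \<le> absorption_time (semi_markov_process Z T) \<omega>" for \<omega>
    unfolding absorption_time_def by (intro Inf_greatest) auto
  have "(\<lambda>\<omega>. \<integral>t. indicator (einterval 0 (absorption_time (semi_markov_process Z T) \<omega>)) t *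
      (\<Sum>i\<in>UNIV. R $ i $ k * of_bool (semi_markov_process Z T t \<omega> = Some i)) \<partial>lborel) \<in> borel_measurable M"
  proof (rule lborel.borel_measurable_lebesgue_integral)
    have "Measurable.pred (M \<Otimes>\<^sub>M lborel) (\<lambda>p. snd p \<in> einterval 0 (absorption_time (semi_markov_process Z T) (fst p)))"
      unfolding einterval_iff by measurable
    moreover have "(\<lambda>p. semi_markov_process Z T (snd p) (fst p)) \<in> measurable (M \<Otimes>\<^sub>M lborel) (count_space UNIV)"
      using X by (simp cong: measurable_cong_sets)
    ultimately show "(\<lambda>(\<omega>, t). indicator (einterval 0 (absorption_time (semi_markov_process Z T) \<omega>)) t *
      (\<Sum>i\<in>UNIV. R $ i $ k * of_bool (semi_markov_process Z T t \<omega> = Some i))) \<in> borel_measurable (M \<Otimes>\<^sub>M lborel)"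
      unfolding case_prod_beta by measurable
  qed
  then show ?thesis
    by (simp add: total_reward_def interval_lebesgue_integral_def set_lebesgue_integral_def nonneg
        del: sum_mult_of_bool_eq)
qed

section \<open>The resolvent equation and the Laplace transform of the reward\<close>

lemma resolvent_matrix_mult:
  "((diag_matrix d - sub_intensity_matrix l Q) *v x) $ i =
     (d $ i + l $ i) * x $ i - l $ i * (\<Sum>j\<in>UNIV. Q $ Some i $ Some j * x $ j)"
  if "Q $ Some i $ Some i = 0"
  for Q :: "real^('p::finite option)^('p option)"
proof -
  have "((diag_matrix d - sub_intensity_matrix l Q) *v x) $ i =
    (\<Sum>j\<in>UNIV. (if j = i then (d $ i + l $ i) * x $ i else 0) - l $ i * (Q $ Some i $ Some j * x $ j))"
    using that by (auto simp: matrix_vector_mult_def diag_matrix_def sub_intensity_matrix_def algebra_simps intro!: sum.cong)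
  also have "\<dots> = (d $ i + l $ i) * x $ i - l $ i * (\<Sum>j\<in>UNIV. Q $ Some i $ Some j * x $ j)"
    by (simp add: sum_subtractf sum_distrib_left)
  finally show ?thesis .
qed

text \<open>
  With \<open>d $ i = s powr \<alpha>\<close> this is the Laplace transform at \<open>s\<close> of the sojourn time in state \<open>i\<close>.
\<close>

definition sojourn_weight :: "real^'p \<Rightarrow> real^'p \<Rightarrow> 'p option \<Rightarrow> real" where
  "sojourn_weight l d i = (case i of None \<Rightarrow> 1 | Some i \<Rightarrow> l $ i / (l $ i + d $ i))"

text \<open>
  Dividing row \<open>i\<close> of the linear system by \<open>l $ i + d $ i\<close> gives the fixed-point equation of the killed
  chain at \<open>Some i\<close>; the right-hand side carries the boundary value \<open>c\<close> at the absorbing state. The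
  case \<open>c = 0\<close> yields invertibility, the case \<open>c = 1\<close> the Laplace transform.
\<close>

lemma resolvent_equation_iff:
  fixes Q :: "real^('p::finite option)^('p option)" and l d x :: "real^'p" and c :: real
  assumes Q: "stochastic_matrix Q" and abs: "absorbing_state Q None"
    and diag: "\<And>i. Q $ Some i $ Some i = 0"
    and l: "\<And>i. 0 < l $ i" and d: "\<And>i. 0 \<le> d $ i"
  defines "v \<equiv> \<lambda>i. case i of None \<Rightarrow> c | Some i \<Rightarrow> x $ i"
  shows "(diag_matrix d - sub_intensity_matrix l Q) *v x = c *\<^sub>R exit_vector l Q \<longleftrightarrow>
    weighted_step Q (sojourn_weight l d) v = v"
proof -
  have None: "weighted_step Q (sojourn_weight l d) v None = v None"
    using stochastic_matrix_absorbingD[OF Q abs] abs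
    by (simp add: weighted_step_def sojourn_weight_def sum_option absorbing_state_def v_def)
  have Some: "weighted_step Q (sojourn_weight l d) v (Some i) = v (Some i) \<longleftrightarrow>
     ((diag_matrix d - sub_intensity_matrix l Q) *v x) $ i = (c *\<^sub>R exit_vector l Q) $ i" for i
  proof -
    have "l $ i / (l $ i + d $ i) * a = b \<longleftrightarrow> l $ i * a = (d $ i + l $ i) * b" for a b
    proof -
      have "l $ i + d $ i \<noteq> 0" using l[of i] d[of i] by simp
      then show ?thesis by (simp add: nonzero_divide_eq_eq mult.commute add.commute)
    qed
    then show ?thesis
      unfolding resolvent_matrix_mult[OF diag]
      by (simp add: weighted_step_def sojourn_weight_def sum_option v_def exit_vector_def)
         (auto simp: distrib_left mult.left_commute[of c] mult.commute[of c])
  qed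
  show ?thesis
    unfolding vec_eq_iff fun_eq_iff Some[symmetric]
    using None by (metis option.exhaust)
qed

theorem mainTheorem1:
  fixes M :: "'a measure"
    and Z :: "nat \<Rightarrow> 'a \<Rightarrow> 'p::finite option"
    and T :: "'p \<Rightarrow> nat \<Rightarrow> 'a \<Rightarrow> real"
    and X :: "real \<Rightarrow> 'a \<Rightarrow> 'p option"
    and Q :: "real^('p option)^('p option)"
    and l \<pi> :: "real^'p"
    and \<alpha> :: real
    and R :: "real^'n::finite^'p"
    and \<theta> :: "real^'n"
  assumes "prob_space M"
    and "0 < \<alpha>" and "\<alpha> \<le> 1"
    and "\<And>i. 0 < l $ i"
    and "markov_chain M Q Z"
    and "absorbing_state Q None"
    and "\<And>i. transient_state Q (Some i)"
    and "\<And>i. Q $ Some i $ Some i = 0"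
    and "\<And>i m. distributed M lborel (T i m) (\<lambda>x. ennreal (mittag_leffler_density \<alpha> (l $ i) x))"
    and "prob_space.indep_vars M (\<lambda>_. borel) (\<lambda>(i, m). T i m) UNIV"
    and "prob_space.indep_set M
           (sets (vimage_algebra (space M) (\<lambda>\<omega> n. Z n \<omega>) (Pi\<^sub>M UNIV (\<lambda>_. count_space UNIV))))
           (sets (vimage_algebra (space M) (\<lambda>\<omega> (i, m). T i m \<omega>) (Pi\<^sub>M UNIV (\<lambda>_. borel))))"
    and "X = semi_markov_process Z T"
    and "\<And>i. \<pi> $ i = \<P>(\<omega> in M. X 0 \<omega> = Some i)"
    and "(\<Sum>i\<in>UNIV. \<pi> $ i) = 1"
    and "\<And>i k. 0 \<le> R $ i $ k"
    and "\<And>k. 0 \<le> \<theta> $ k"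
  shows "let A = diag_matrix (\<chi> i. (\<Sum>k\<in>UNIV. R $ i $ k * \<theta> $ k) powr \<alpha>) - sub_intensity_matrix l Q
     in invertible A \<and>
        (\<integral>\<omega>. exp (- (total_reward X R \<omega> \<bullet> \<theta>)) \<partial>M) = \<pi> \<bullet> (matrix_inv A *v exit_vector l Q)"
proof -
  interpret prob_space M by fact
  define d where "d = (\<chi> i. (\<Sum>k\<in>UNIV. R $ i $ k * \<theta> $ k) powr \<alpha>)"
  define A where "A = diag_matrix d - sub_intensity_matrix l Q"
  define s where "s i = (\<Sum>k\<in>UNIV. R $ i $ k * \<theta> $ k)" for i
  have s: "0 \<le> s i" for i unfolding s_def using assms by (intro sum_nonneg mult_nonneg_nonneg)
  have d: "0 \<le> d $ i" "d $ i = s i powr \<alpha>" for i by (auto simp: d_def s_def)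
  have Q: "stochastic_matrix Q" and Z[measurable]: "\<And>n. Z n \<in> measurable M (count_space UNIV)"
    using assms(5) by (auto simp: markov_chain_def)
  have [measurable]: "T i m \<in> borel_measurable M" for i m
    using distributed_measurable[OF assms(9)] by simp
  let ?\<phi> = "sojourn_weight l d"
  have \<phi>: "0 \<le> ?\<phi> i" "?\<phi> i \<le> 1" "?\<phi> None = 1" for i
  proof -
    have "0 < l $ j \<and> 0 \<le> d $ j \<and> 0 < l $ j + d $ j" for j using assms(4)[of j] d(1)[of j] by simp
    then show "0 \<le> ?\<phi> i" "?\<phi> i \<le> 1" "?\<phi> None = 1"
      by (auto simp: sojourn_weight_def less_imp_le split: option.split)
  qed
  note resolvent = resolvent_equation_iff[OF Q assms(6,8,4) d(1), folded A_def]

  have inv: "invertible A"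
    unfolding invertible_left_inverse matrix_left_invertible_ker
  proof (intro allI impI)
    fix x assume "A *v x = 0"
    then have "weighted_step Q ?\<phi> (\<lambda>i. case i of None \<Rightarrow> 0 | Some i \<Rightarrow> x $ i) = (\<lambda>i. case i of None \<Rightarrow> 0 | Some i \<Rightarrow> x $ i)"
      using resolvent[of x 0] by simp
    from weighted_step_fixpoint_zero[OF Q assms(7) \<phi>(1,2) this, of "Some _"]
    show "x = 0" by (simp add: vec_eq_iff)
  qed
  define x where "x = matrix_inv A *v exit_vector l Q"
  have "A ** matrix_inv A = mat 1"
    using inv unfolding invertible_def matrix_inv_def by (rule someI2_ex) simp
  then have Ax: "A *v x = exit_vector l Q"
    by (simp add: x_def matrix_vector_mul_assoc)
  define w where "w i = (case i of None \<Rightarrow> 1 | Some i \<Rightarrow> x $ i)" for i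
  have w_fix: "weighted_step Q ?\<phi> w = w"
    unfolding w_def using resolvent[of x 1] Ax by simp
  let ?one = "\<lambda>_ :: 'p option. 1 :: real"
  have w_lim: "(\<lambda>n. (weighted_step Q ?\<phi> ^^ n) ?one i) \<longlonglongrightarrow> w i" for i
  proof (rule weighted_step_iterates_tendsto[where \<phi>="?\<phi>" and f="?one" and w=w, OF Q assms(7,6) \<phi>])
    show "weighted_step Q ?\<phi> ?one i \<le> ?one i" for i
      using \<phi>(2)[of i] stochastic_matrixD(2)[OF Q] by (simp add: weighted_step_def)
  qed (auto simp: w_fix, simp add: w_def)

  have pos: "AE \<omega> in M. \<forall>i m. 0 < T i m \<omega>"
    using mittag_leffler_AE_pos[OF assms(9)] by (simp add: AE_all_countable)
  have absorbed: "AE \<omega> in M. \<exists>n. Z n \<omega> = None"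
    by (rule markov_chain_absorbed_AE[OF assms(1,5,6,7)])
  have stays: "AE \<omega> in M. \<forall>n. Z n \<omega> = None \<longrightarrow> Z (Suc n) \<omega> = None"
    using markov_chain_stays_absorbed[OF assms(1,5,6)] by (simp add: AE_all_countable)

  \<comment> \<open>The factor \<open>exp (- \<langle>Y, \<theta>\<rangle>)\<close> restricted to the first \<open>n\<close> sojourns, eventually constant almost surely.\<close>
  define W where "W n \<omega> = (\<Prod>m<n. case Z m \<omega> of None \<Rightarrow> 1 | Some i \<Rightarrow> exp (- (s i * T i m \<omega>)))" for n \<omega>
  have [measurable]: "W n \<in> borel_measurable M" for n
  proof -
    have "W n = (\<lambda>\<omega>. \<Prod>m<n. \<Sum>j\<in>UNIV. of_bool (Z m \<omega> = j) * (case j of None \<Rightarrow> 1 | Some i \<Rightarrow> exp (- (s i * T i m \<omega>))))"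
      by (auto simp: W_def fun_eq_iff of_bool_def if_distrib[of "\<lambda>x. x * _"] cong: if_cong intro!: prod.cong)
    moreover have "(\<lambda>\<omega>. case j of None \<Rightarrow> 1 | Some i \<Rightarrow> exp (- (s i * T i m \<omega>))) \<in> borel_measurable M" for j m
      by (cases j) auto
    ultimately show ?thesis by simp
  qed
  have W_bound: "AE \<omega> in M. norm (W n \<omega>) \<le> 1" for n
    using pos
  proof eventually_elim
    case (elim \<omega>)
    have "0 \<le> s i * T i m \<omega>" for i m
      using s[of i] less_imp_le[OF elim[rule_format]] by (rule mult_nonneg_nonneg)
    then have "0 \<le> W n \<omega>" "W n \<omega> \<le> 1"
      unfolding W_def by (auto intro!: prod_nonneg prod_le_1 split: option.split)
    then show ?case by simp
  qed

  have W_lim: "AE \<omega> in M. (\<lambda>n. W n \<omega>) \<longlonglongrightarrow> exp (- (total_reward X R \<omega> \<bullet> \<theta>))"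
    using pos absorbed stays
  proof eventually_elim
    case (elim \<omega>)
    define N where "N = (LEAST n. Z n \<omega> = None)"
    have N: "Z N \<omega> = None"
      unfolding N_def using elim(2) by (rule LeastI_ex)
    have before: "Z m \<omega> \<noteq> None" if "m < N" for m
      using that unfolding N_def by (rule not_less_Least)
    have after: "Z n \<omega> = None" if "N \<le> n" for n
      using that N elim(3) by (induction n rule: dec_induct) auto
    have reward: "total_reward X R \<omega> $ k =
        (\<Sum>m<N. case Z m \<omega> of None \<Rightarrow> 0 | Some i \<Rightarrow> R $ i $ k * T i m \<omega>)" for k
      unfolding assms(12) by (rule total_reward_eq) (use elim(1) N before in blast)+
    have "W n \<omega> = exp (- (total_reward X R \<omega> \<bullet> \<theta>))" if "N \<le> n" for n
    proof -
      have "W n \<omega> = W N \<omega>"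
        unfolding W_def using that after by (intro prod.mono_neutral_right) auto
      also have "\<dots> = exp (\<Sum>m<N. case Z m \<omega> of None \<Rightarrow> 0 | Some i \<Rightarrow> - (s i * T i m \<omega>))"
        unfolding W_def by (subst exp_sum) (auto intro!: prod.cong split: option.split)
      also have "(\<Sum>m<N. case Z m \<omega> of None \<Rightarrow> 0 | Some i \<Rightarrow> - (s i * T i m \<omega>)) =
         - (\<Sum>m<N. \<Sum>k\<in>UNIV. (case Z m \<omega> of None \<Rightarrow> 0 | Some i \<Rightarrow> R $ i $ k * T i m \<omega>) * \<theta> $ k)"
        unfolding sum_negf[symmetric]
        by (intro sum.cong refl) (auto simp: s_def sum_distrib_left sum_distrib_right sum_negf mult_ac split: option.split)
      also have "(\<Sum>m<N. \<Sum>k\<in>UNIV. (case Z m \<omega> of None \<Rightarrow> 0 | Some i \<Rightarrow> R $ i $ k * T i m \<omega>) * \<theta> $ k) =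
          total_reward X R \<omega> \<bullet> \<theta>"
        unfolding inner_vec_def reward
        by (simp add: sum_distrib_right) (rule sum.swap)
      finally show ?thesis .
    qed
    then show ?case by (intro tendsto_eventually) (auto simp: eventually_sequentially)
  qed

  have W_val: "(\<integral>\<omega>. W n \<omega> \<partial>M) = (\<integral>\<omega>. (weighted_step Q ?\<phi> ^^ n) ?one (Z 0 \<omega>) \<partial>M)" for n
  proof -
    have "(\<integral>\<omega>. W n \<omega> \<partial>M) = (\<integral>\<omega>. (\<Prod>m<n. case Z m \<omega> of None \<Rightarrow> 1 | Some i \<Rightarrow> l $ i / (l $ i + d $ i)) \<partial>M)"
      unfolding W_def
    proof (rule expectation_sojourn_product[OF assms(1) Z assms(10,11), where f="\<lambda>i x. exp (- (s i * x))"])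
      show "integrable M (\<lambda>\<omega>. exp (- (s i * T i m \<omega>)))" for i m
      proof (rule integrable_const_bound[where B=1])
        show "AE \<omega> in M. norm (exp (- (s i * T i m \<omega>))) \<le> 1"
          using pos by (rule eventually_mono) (simp add: s less_imp_le)
      qed measurable
      show "(\<integral>\<omega>. exp (- (s i * T i m \<omega>)) \<partial>M) = l $ i / (l $ i + d $ i)" for i m
        unfolding d(2) by (rule mittag_leffler_expectation_exp[OF assms(1,2,3,4,9) s])
    qed auto
    also have "\<dots> = (\<integral>\<omega>. (\<Prod>m<n. ?\<phi> (Z m \<omega>)) * ?one (Z n \<omega>) \<partial>M)"
      by (simp add: sojourn_weight_def)
    also have "\<dots> = (\<integral>\<omega>. (weighted_step Q ?\<phi> ^^ n) ?one (Z 0 \<omega>) \<partial>M)"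
      by (rule markov_chain_expectation_prod[OF assms(1,5)])
    finally show ?thesis .
  qed

  have lim1: "(\<lambda>n. \<integral>\<omega>. W n \<omega> \<partial>M) \<longlonglongrightarrow> (\<Sum>i\<in>UNIV. w i * \<P>(\<omega> in M. Z 0 \<omega> = i))"
    unfolding W_val expectation_finite_valued[OF Z] by (intro tendsto_intros w_lim)
  have init: "\<P>(\<omega> in M. Z 0 \<omega> = Some i) = \<pi> $ i" for i
    unfolding assms(13)
  proof (rule prob_eq_AE)
    show "AE \<omega> in M. Z 0 \<omega> = Some i \<longleftrightarrow> X 0 \<omega> = Some i"
      using pos by (rule eventually_mono) (simp add: assms(12) semi_markov_process_0)
    have [measurable]: "X 0 \<in> measurable M (count_space UNIV)"
      unfolding assms(12) by (rule measurable_semi_markov_process) auto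
    show "{\<omega> \<in> space M. Z 0 \<omega> = Some i} \<in> events" "{\<omega> \<in> space M. X 0 \<omega> = Some i} \<in> events"
      by measurable
  qed
  have "(\<Sum>i\<in>UNIV. \<P>(\<omega> in M. Z 0 \<omega> = i)) = 1"
    using expectation_finite_valued[OF Z, of "\<lambda>_. 1" 0] by (simp add: prob_space)
  then have init_None: "\<P>(\<omega> in M. Z 0 \<omega> = None) = 0"
    using assms(14) by (simp add: sum_option init)
  have [measurable]: "(\<lambda>\<omega>. exp (- (total_reward X R \<omega> \<bullet> \<theta>))) \<in> borel_measurable M"
  proof -
    have [measurable]: "(\<lambda>\<omega>. total_reward X R \<omega> $ k) \<in> borel_measurable M" for k
      unfolding assms(12) by (rule borel_measurable_total_reward) auto
    show ?thesis unfolding inner_vec_def by measurable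
  qed
  have lim2: "(\<lambda>n. \<integral>\<omega>. W n \<omega> \<partial>M) \<longlonglongrightarrow> (\<integral>\<omega>. exp (- (total_reward X R \<omega> \<bullet> \<theta>)) \<partial>M)"
    by (rule integral_dominated_convergence[where w="\<lambda>_. 1", OF _ _ _ W_lim W_bound]) auto
  have "(\<integral>\<omega>. exp (- (total_reward X R \<omega> \<bullet> \<theta>)) \<partial>M) = (\<Sum>i\<in>UNIV. w i * \<P>(\<omega> in M. Z 0 \<omega> = i))"
    using LIMSEQ_unique[OF lim2 lim1] .
  also have "\<dots> = \<pi> \<bullet> x"
    by (simp add: sum_option init init_None w_def inner_vec_def mult.commute)
  finally show ?thesis
    using inv unfolding Let_def x_def A_def d_def by blast
qed

end
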